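(* Let $n\ge1$, let $\boldsymbol\alpha=(\alpha_1,\dots,\alpha_n)\in\mathbb{R}^n$ with $\alpha_k\notin\pi\mathbb{Z}$ for $k=1,\dots,n$, and let $1<p<\infty$. Then there is a constant $C>0$ such that for every $f\in S(\mathbb{R}^n)$ and all $1\le j,k\le n$, $$\Big\|\frac{\partial^2(e_{\boldsymbol\alpha}f)}{\partial y_k\partial y_j}\Big\|_{L^p}\le C\,\big\|\Delta(e_{\boldsymbol\alpha}f)\big\|_{L^p},\qquad\text{where }\ \Delta(e_{\boldsymbol\alpha}f)=\sum_{j=1}^n\frac{\partial^2(e_{\boldsymbol\alpha}f)}{\partial y_j^2}.$$
   Context: $S(\mathbb{R}^n)$ is the Schwartz class and norms are those of $L^p(\mathbb{R}^n)$. The chirp is $e_{\boldsymbol\alpha}(\boldsymbol y)=\exp\big(\tfrac{i}{2}\sum_{k=1}^n y_k^2\cot\alpha_k\big)$. *)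

theory Defs
  imports "HOL-Analysis.Analysis"
begin

definition partial_deriv ::
  "'n::finite \<Rightarrow> (real ^ 'n \<Rightarrow> complex) \<Rightarrow> real ^ 'n \<Rightarrow> complex" where
  "partial_deriv k f = (\<lambda>y. vector_derivative (\<lambda>t. f (y + t *\<^sub>R axis k 1)) (at 0))"

text \<open>Derivatives of arbitrary order are indexed by the list of coordinates of differentiation,
  the head of the list being the last derivative taken.\<close>

primrec iterated_partial ::
  "'n::finite list \<Rightarrow> (real ^ 'n \<Rightarrow> complex) \<Rightarrow> real ^ 'n \<Rightarrow> complex" where
  "iterated_partial [] f = f"
| "iterated_partial (k # ks) f = partial_deriv k (iterated_partial ks f)"

text \<open>Requiring Frechet differentiability of every iterated partial derivative makes all of
  them exist and be continuous, so this is the usual infinite differentiability; in particular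
  \<^const>\<open>vector_derivative\<close> is never taken where the derivative does not exist.\<close>

definition smooth :: "(real ^ 'n::finite \<Rightarrow> complex) \<Rightarrow> bool" where
  "smooth f \<longleftrightarrow> (\<forall>ks y. iterated_partial ks f differentiable (at y))"

definition schwartz :: "(real ^ 'n::finite \<Rightarrow> complex) set" where
  "schwartz = {f. smooth f \<and>
     (\<forall>(m :: 'n \<Rightarrow> nat) ks.
        bounded (range (\<lambda>y. of_real (\<Prod>i\<in>UNIV. (y $ i) ^ m i) * iterated_partial ks f y)))}"

definition laplacian :: "(real ^ 'n::finite \<Rightarrow> complex) \<Rightarrow> real ^ 'n \<Rightarrow> complex" where
  "laplacian f = (\<lambda>y. \<Sum>j\<in>UNIV. partial_deriv j (partial_deriv j f) y)"

definition chirp :: "real ^ 'n::finite \<Rightarrow> real ^ 'n \<Rightarrow> complex" where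
  "chirp \<alpha> y = exp (\<i> / 2 * of_real (\<Sum>k\<in>UNIV. (y $ k)\<^sup>2 * cot (\<alpha> $ k)))"

text \<open>The norm takes values in \<^typ>\<open>ennreal\<close>, so that it is infinite, rather than a junk value,
  on functions outside \<open>L\<^sup>p\<close>.\<close>

definition Lp_norm :: "real \<Rightarrow> (real ^ 'n::finite \<Rightarrow> complex) \<Rightarrow> ennreal" where
  "Lp_norm p f =
     (let I = (\<integral>\<^sup>+ y. ennreal (norm (f y) powr p) \<partial>lebesgue)
      in if I = \<infinity> then \<infinity> else ennreal (enn2real I powr (1 / p)))"

end

theory Submission
  imports Defs
begin

text \<open>The chirp times a Schwartz function is again twice continuously differentiable with
  rapidly decaying second derivatives, so only the Calderon-Zygmund inequality for the Hessian
  has to be shown. It is obtained without singular integrals, from a Bellman function argument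
  for a random walk in continuous space: \<open>T\<close> averages over steps \<open>\<plusminus>w\<close> in a list of directions, and
  for \<open>f = T\<^sup>2 g - g\<close> telescoping gives
  \<open>\<integral> d\<^sub>w\<^sup>2 g h = (\<Sum>m. \<integral> d\<^sub>w (T\<^sup>m f) d\<^sub>w (T\<^sup>m h))\<close>, where \<open>d\<^sub>w\<close> is a symmetric difference. A function
  \<open>\<Phi>(x, y) \<le> C (\<bar>x\<bar>\<^sup>p + \<bar>y\<bar>\<^sup>q)\<close> which is midpoint convex with a gain of \<open>\<bar>a b\<bar>\<close> along \<open>(a, b)\<close> bounds
  the right-hand side by \<open>\<integral> \<Phi>(f, h)\<close>. Taking \<open>h = t sgn(d\<^sub>w\<^sup>2 g) \<bar>d\<^sub>w\<^sup>2 g\<bar>\<^bsup>p-1\<^esup>\<close> with \<open>t\<close> small, then steps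
  of length tending to 0 in an orthonormal system of directions, gives the bound for pure second
  derivatives by the Laplacian; mixed ones arise from the directions \<open>(e\<^sub>i \<plusminus> e\<^sub>j) / \<surd>2\<close>.\<close>

section \<open>The Bellman function\<close>

text \<open>Along the walk the energy \<open>\<integral> \<Phi>(T^m f, T^m h)\<close> decreases, and
  each step releases at least the integral of the absolute value of
  \<open>d_w T^m f * d_w T^m h\<close>. Since \<open>T\<close> is self-adjoint and
  \<open>d_w\<close> antisymmetric, the pairing at step \<open>m\<close> is minus that of
  \<open>d_w^2 T^(2m) f\<close> with \<open>h\<close>; this doubled power is the reason for
  \<open>T^2\<close> in \<open>f\<close>. The last term of the telescoping sum vanishes in the limit
  by the same energy argument with \<open>(x^2 + y^2) / 2\<close>, which makes the squared
  \<open>L^2\<close> norms of \<open>d_w T^m g\<close> summable. All constants come from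
  \<open>\<Phi>\<close>, hence from \<open>p\<close> alone, and not from the list of directions or
  the step length \<open>e\<close>. Both sides may therefore be divided by \<open>e^(2p)\<close>
  before the limit is taken. Two obstacles shape the rest. Half of the integral of the
  \<open>p\<close>-th power of \<open>d_w^2 g\<close> is absorbed into the other side, which
  requires it to be finite, so \<open>h\<close> is first cut off to a ball. And
  \<open>\<Phi>\<close> takes two real arguments, so a complex function is split into real and
  imaginary part.\<close>

lemma second_difference_ge:
  fixes F :: "real \<Rightarrow> real"
  assumes F: "\<And>t. (F has_real_derivative F1 t) (at t)"
    and F1: "\<And>t. (F1 has_real_derivative F2 t) (at t)"
    and ge: "\<And>t. F2 t \<ge> c"
  shows "F 1 + F (-1) - 2 * F 0 \<ge> c"
proof -
  \<comment> \<open>Twice the even part of \<open>F\<close>, less a parabola: its first derivative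
    vanishes at 0 by symmetry and its second is nonnegative by \<open>ge\<close>, so
    \<open>G 0 <= G 1\<close>, which is the claim.\<close>
  define G where "G t = F t + F (- t) - c * t\<^sup>2" for t
  define G1 where "G1 t = F1 t - F1 (- t) - 2 * c * t" for t
  have dG: "(G has_real_derivative G1 t) (at t)" for t
    unfolding G_def G1_def
    by (auto intro!: derivative_eq_intros F DERIV_chain2[OF F])
  have dG1: "(G1 has_real_derivative F2 t + F2 (- t) - 2 * c) (at t)" for t
    unfolding G1_def
    by (auto intro!: derivative_eq_intros F1 DERIV_chain2[OF F1])
  have "G1 0 \<le> G1 t" if "0 \<le> t" for t
  proof (rule DERIV_nonneg_imp_nondecreasing[OF that])
    fix x show "\<exists>y. (G1 has_real_derivative y) (at x) \<and> 0 \<le> y"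
      using dG1[of x] ge[of x] ge[of "- x"] by (intro exI[of _ "F2 x + F2 (- x) - 2 * c"]) auto
  qed
  then have "G 0 \<le> G 1"
    by (intro DERIV_nonneg_imp_nondecreasing[of 0 1 G]) (use dG in \<open>auto simp: G1_def intro!: exI\<close>)
  then show ?thesis by (simp add: G_def)
qed

text \<open>The left-hand side is the second derivative along direction \<open>(a, b)\<close> of the function
  \<open>bellman\<close> below, with \<open>s = x\<^sup>2 + \<eta>\<close>, \<open>k = s\<close> to the power \<open>r - 2\<close> and \<open>\<tau> = w\<close> to the power \<open>(r - 1) / (2 r)\<close>.\<close>

lemma bellman_hessian_ge:
  fixes r s x y a b k w \<tau> :: real
  assumes r: "r \<ge> 1" and s: "0 < s" "x\<^sup>2 \<le> s" and k: "0 < k" and w: "w = k * s\<^sup>2 + y\<^sup>2"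
    and \<tau>: "0 < \<tau>" "s * \<tau>\<^sup>2 \<le> w"
  defines "\<beta> \<equiv> (r - 1) / (2 * r)" and "\<gamma> \<equiv> (r + 1) / (2 * r)"
    and "w1 \<equiv> 2 * r * k * s * x * a + 2 * y * b"
    and "w2 \<equiv> 4 * r * (r - 1) * k * x\<^sup>2 * a\<^sup>2 + 2 * r * k * s * a\<^sup>2 + 2 * b\<^sup>2"
  shows "16 * r * (\<gamma> * w2 / \<tau> - \<gamma> * \<beta> * w1\<^sup>2 / (\<tau> * w)) + 2 * a\<^sup>2 * \<tau> + 4 * x * a * \<beta> * \<tau> / w * w1
      + s * \<beta> * \<tau> / w * w2 - s * \<beta> * \<gamma> * \<tau> / w\<^sup>2 * w1\<^sup>2 \<ge> 2 * \<bar>a * b\<bar>"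
proof -
  have w0: "0 < w" using s k w by (simp add: add_pos_nonneg)
  have \<beta>: "0 \<le> \<beta>" "\<beta> \<le> 1/2" and \<gamma>: "1/2 \<le> \<gamma>" using r by (auto simp: \<beta>_def \<gamma>_def field_simps)
  \<comment> \<open>Lagrange's identity for the Cauchy-Schwarz inequality applied to
    \<open>w1 / 2 = (sqrt k * s) * (r * sqrt k * x * a) + y * b\<close>.\<close>
  have "w * (4 * r\<^sup>2 * k * x\<^sup>2 * a\<^sup>2 + 4 * b\<^sup>2) - w1\<^sup>2 = 4 * k * (s * b - y * r * x * a)\<^sup>2"
    unfolding w w1_def by algebra
  moreover have "4 * k * (s * b - y * r * x * a)\<^sup>2 \<ge> 0" using k by simp
  ultimately have "w1\<^sup>2 \<le> w * (4 * r\<^sup>2 * k * x\<^sup>2 * a\<^sup>2 + 4 * b\<^sup>2)" by linarith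
  then have cs: "w1\<^sup>2 / w \<le> 4 * r\<^sup>2 * k * x\<^sup>2 * a\<^sup>2 + 4 * b\<^sup>2"
    using w0 by (simp add: field_simps)
  have kx: "0 \<le> k * x\<^sup>2 * a\<^sup>2" "0 \<le> k * s * a\<^sup>2" using k s by auto
  \<comment> \<open>The second derivative of \<open>w powr \<gamma>\<close> is
    \<open>\<gamma> / \<tau>\<close> times this difference. Of the \<open>b^2\<close> term,
    \<open>2 - 4 * \<beta> = 2 / r\<close> survives; the factor \<open>r\<close> in front of
    \<open>w powr \<gamma>\<close> in \<open>bellman\<close> makes up for it.\<close>
  have "w2 - \<beta> * (w1\<^sup>2 / w) \<ge> w2 - \<beta> * (4 * r\<^sup>2 * k * x\<^sup>2 * a\<^sup>2 + 4 * b\<^sup>2)"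
    using mult_left_mono[OF cs \<beta>(1)] by linarith
  also have "w2 - \<beta> * (4 * r\<^sup>2 * k * x\<^sup>2 * a\<^sup>2 + 4 * b\<^sup>2)
      = 2 * r * (r - 1) * (k * x\<^sup>2 * a\<^sup>2) + 2 * r * (k * s * a\<^sup>2) + 2 / r * b\<^sup>2"
    using r by (simp add: w2_def \<beta>_def field_simps power2_eq_square)
  also have "\<dots> \<ge> 2 / r * b\<^sup>2" using r kx by simp
  finally have 1: "w2 - \<beta> * (w1\<^sup>2 / w) \<ge> 2 / r * b\<^sup>2" .
  have 2: "16 * r * (\<gamma> * w2 / \<tau> - \<gamma> * \<beta> * w1\<^sup>2 / (\<tau> * w)) \<ge> 16 * b\<^sup>2 / \<tau>"
  proof -
    have "16 * b\<^sup>2 / \<tau> \<le> 32 * \<gamma> * b\<^sup>2 / \<tau>"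
      using \<gamma> \<tau> by (intro divide_right_mono mult_right_mono) auto
    also have "\<dots> = 16 * r * (\<gamma> / \<tau>) * (2 / r * b\<^sup>2)" using r by simp
    also have "\<dots> \<le> 16 * r * (\<gamma> / \<tau>) * (w2 - \<beta> * (w1\<^sup>2 / w))"
      using 1 r \<gamma> \<tau> by (intro mult_left_mono) auto
    also have "\<dots> = 16 * r * (\<gamma> * w2 / \<tau> - \<gamma> * \<beta> * w1\<^sup>2 / (\<tau> * w))"
      using \<tau> w0 by (simp add: field_simps)
    finally show ?thesis .
  qed
  \<comment> \<open>Up to the factor \<open>\<beta> * \<tau> / w\<close> these are the terms of the
    second derivative of \<open>s * w powr \<beta>\<close> in which \<open>w\<close> is
    differentiated. Only the mixed term and a multiple of \<open>s * b^2\<close> can be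
    negative.\<close>
  have "4 * x * a * w1 + s * (w2 - \<gamma> * (w1\<^sup>2 / w)) \<ge>
      4 * x * a * w1 + s * (w2 - \<gamma> * (4 * r\<^sup>2 * k * x\<^sup>2 * a\<^sup>2 + 4 * b\<^sup>2))"
    using mult_left_mono[OF cs, of \<gamma>] \<gamma> s by simp
  also have "4 * x * a * w1 + s * (w2 - \<gamma> * (4 * r\<^sup>2 * k * x\<^sup>2 * a\<^sup>2 + 4 * b\<^sup>2))
      = 2 * r * (r + 1) * s * (k * x\<^sup>2 * a\<^sup>2) + 2 * r * s * (k * s * a\<^sup>2) + 8 * x * y * a * b - 2 / r * s * b\<^sup>2"
    using r by (simp add: w1_def w2_def \<gamma>_def field_simps power2_eq_square)
  also have "\<dots> \<ge> 8 * x * y * a * b - 2 / r * s * b\<^sup>2" using r kx s by simp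
  also have "8 * x * y * a * b - 2 / r * s * b\<^sup>2 \<ge> - (8 * \<bar>x * y\<bar> * \<bar>a * b\<bar>) - 2 * s * b\<^sup>2"
  proof -
    have "\<bar>x * y\<bar> * \<bar>a * b\<bar> \<ge> - (x * y * a * b)" by (simp add: abs_mult[symmetric] mult.assoc)
    moreover have "2 / r * s * b\<^sup>2 \<le> 2 * s * b\<^sup>2" using r s by (intro mult_right_mono) (auto simp: field_simps)
    ultimately show ?thesis by linarith
  qed
  finally have 3: "4 * x * a * w1 + s * (w2 - \<gamma> * (w1\<^sup>2 / w)) \<ge> - (8 * \<bar>x * y\<bar> * \<bar>a * b\<bar>) - 2 * s * b\<^sup>2" .
  \<comment> \<open>Geometric mean of \<open>x^2 * \<tau>^2 <= w\<close> and
    \<open>y^2 <= w\<close>; it reduces the mixed term to a multiple of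
    \<open>\<bar>a * b\<bar>\<close>.\<close>
  have xy: "\<tau> * \<bar>x * y\<bar> \<le> w"
  proof -
    have "(\<tau> * \<bar>x * y\<bar>)\<^sup>2 = (x\<^sup>2 * \<tau>\<^sup>2) * y\<^sup>2" by (simp add: power_mult_distrib)
    also have "\<dots> \<le> (s * \<tau>\<^sup>2) * y\<^sup>2" using s by (intro mult_right_mono) auto
    also have "\<dots> \<le> w * w"
    proof (rule mult_mono[OF \<tau>(2)])
      show "y\<^sup>2 \<le> w" using k unfolding w by simp
    qed (use w0 in simp_all)
    also have "w * w = w\<^sup>2" by (simp only: power2_eq_square)
    finally show ?thesis by (rule power2_le_imp_le) (use w0 in simp)
  qed
  have 4: "4 * x * a * \<beta> * \<tau> / w * w1 + s * \<beta> * \<tau> / w * w2 - s * \<beta> * \<gamma> * \<tau> / w\<^sup>2 * w1\<^sup>2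
      \<ge> - (4 * \<bar>a * b\<bar>) - b\<^sup>2 / \<tau>"
  proof -
    have "\<beta> * (8 * \<bar>x * y\<bar> * \<bar>a * b\<bar> + 2 * s * b\<^sup>2) \<le> 1/2 * (8 * \<bar>x * y\<bar> * \<bar>a * b\<bar> + 2 * s * b\<^sup>2)"
      using \<beta> s by (intro mult_right_mono) auto
    then have "\<tau> / w * (\<beta> * (8 * \<bar>x * y\<bar> * \<bar>a * b\<bar> + 2 * s * b\<^sup>2)) \<le> \<tau> / w * (1/2 * (8 * \<bar>x * y\<bar> * \<bar>a * b\<bar> + 2 * s * b\<^sup>2))"
      using \<tau> w0 by (intro mult_left_mono) auto
    also have "\<dots> = 4 * (\<tau> * \<bar>x * y\<bar> / w) * \<bar>a * b\<bar> + (s * \<tau>\<^sup>2 / w) * (b\<^sup>2 / \<tau>)"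
      using \<tau> w0 by (simp add: field_simps power2_eq_square)
    also have "\<dots> \<le> 4 * 1 * \<bar>a * b\<bar> + 1 * (b\<^sup>2 / \<tau>)"
      using xy \<tau> w0 by (intro add_mono mult_right_mono mult_left_mono) auto
    finally have "\<tau> / w * (\<beta> * (- (8 * \<bar>x * y\<bar> * \<bar>a * b\<bar>) - 2 * s * b\<^sup>2)) \<ge> - (4 * \<bar>a * b\<bar>) - b\<^sup>2 / \<tau>"
      by (simp add: algebra_simps)
    also have "\<tau> / w * (\<beta> * (4 * x * a * w1 + s * (w2 - \<gamma> * (w1\<^sup>2 / w)))) \<ge> \<tau> / w * (\<beta> * (- (8 * \<bar>x * y\<bar> * \<bar>a * b\<bar>) - 2 * s * b\<^sup>2))"
      using 3 \<tau> w0 \<beta> by (intro mult_left_mono) auto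
    also have "\<tau> / w * (\<beta> * (4 * x * a * w1 + s * (w2 - \<gamma> * (w1\<^sup>2 / w)))) =
      4 * x * a * \<beta> * \<tau> / w * w1 + s * \<beta> * \<tau> / w * w2 - s * \<beta> * \<gamma> * \<tau> / w\<^sup>2 * w1\<^sup>2"
      using w0 by (simp add: field_simps power2_eq_square)
    finally show ?thesis by simp
  qed
  \<comment> \<open>Arithmetic-geometric mean inequality, pairing \<open>a^2 * \<tau>\<close> from
    the second summand of \<open>bellman\<close> with \<open>b^2 / \<tau>\<close> from the first.
    The gain 8 minus the error 4 exceeds the required 2, and \<open>8 + 1 <= 16\<close> multiples of
    \<open>b^2 / \<tau>\<close> are used.\<close>
  have "0 \<le> 2 / \<tau> * (\<tau> * \<bar>a\<bar> - 2 * \<bar>b\<bar>)\<^sup>2" using \<tau> by simp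
  also have "\<dots> = 2 * a\<^sup>2 * \<tau> + 8 * b\<^sup>2 / \<tau> - 8 * \<bar>a * b\<bar>"
    using \<tau> by (simp add: field_simps power2_eq_square abs_mult)
  finally have "2 * a\<^sup>2 * \<tau> + 8 * b\<^sup>2 / \<tau> \<ge> 8 * \<bar>a * b\<bar>" by simp
  moreover have "b\<^sup>2 / \<tau> \<ge> 0" using \<tau> by simp
  ultimately show ?thesis using 2 4 by linarith
qed

text \<open>A smooth substitute for the Nazarov-Treil function, for \<open>p = r + 1 \<ge> 2\<close>. The parameter \<open>\<eta> > 0\<close>
  keeps the bases of the powers away from 0; it is sent to 0 afterwards.\<close>

definition bellman :: "real \<Rightarrow> real \<Rightarrow> real \<Rightarrow> real \<Rightarrow> real" where
  "bellman r \<eta> x y = (let s = x\<^sup>2 + \<eta>; w = s powr r + y\<^sup>2 in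
     16 * r * w powr ((r + 1) / (2 * r)) + s * w powr ((r - 1) / (2 * r)))"

lemma bellman_midpoint_pos:
  fixes r \<eta> x y a b :: real
  assumes r: "r \<ge> 1" and \<eta>: "0 < \<eta>"
  shows "bellman r \<eta> (x + a) (y + b) + bellman r \<eta> (x - a) (y - b)
    \<ge> 2 * bellman r \<eta> x y + 2 * \<bar>a * b\<bar>"
proof -
  define \<beta> where "\<beta> = (r - 1) / (2 * r)"
  define \<gamma> where "\<gamma> = (r + 1) / (2 * r)"
  have \<gamma>\<beta>: "\<gamma> = 1 - \<beta>" using r by (simp add: \<beta>_def \<gamma>_def field_simps)
  define X where "X t = x + t * a" for t
  define Y where "Y t = y + t * b" for t
  define s where "s t = (X t)\<^sup>2 + \<eta>" for t
  define S where "S c t = s t powr c" for c t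
  define w where "w t = S r t + (Y t)\<^sup>2" for t
  define W where "W c t = w t powr c" for c t
  define w1 where "w1 t = 2 * r * S (r - 1) t * X t * a + 2 * Y t * b" for t
  define w2 where "w2 t = 4 * r * (r - 1) * S (r - 2) t * (X t)\<^sup>2 * a\<^sup>2 + 2 * r * S (r - 1) t * a\<^sup>2 + 2 * b\<^sup>2" for t
  define F where "F t = 16 * r * W \<gamma> t + s t * W \<beta> t" for t
  define F1 where "F1 t = 16 * r * (\<gamma> * W (\<gamma> - 1) t * w1 t) + (2 * X t * a * W \<beta> t
      + s t * (\<beta> * W (\<beta> - 1) t * w1 t))" for t
  define F2 where "F2 t = 16 * r * (\<gamma> * ((\<gamma> - 1) * W (\<gamma> - 2) t * w1 t * w1 t + W (\<gamma> - 1) t * w2 t))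
     + (2 * a\<^sup>2 * W \<beta> t + 2 * X t * a * (\<beta> * W (\<beta> - 1) t * w1 t)
      + (2 * X t * a * (\<beta> * W (\<beta> - 1) t * w1 t)
      + s t * (\<beta> * ((\<beta> - 1) * W (\<beta> - 2) t * w1 t * w1 t + W (\<beta> - 1) t * w2 t))))" for t
  have s0: "s t > 0" for t using \<eta> by (simp add: s_def add_nonneg_pos)
  have w0: "w t > 0" for t using s0[of t] by (simp add: w_def S_def add_pos_nonneg)
  have dX: "(X has_real_derivative a) (at t)" for t
    unfolding X_def by (auto intro!: derivative_eq_intros)
  have dY: "(Y has_real_derivative b) (at t)" for t
    unfolding Y_def by (auto intro!: derivative_eq_intros)
  have ds: "(s has_real_derivative 2 * X t * a) (at t)" for t
    unfolding s_def by (auto intro!: derivative_eq_intros dX)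
  have dS: "(S c has_real_derivative c * S (c - 1) t * (2 * X t * a)) (at t)" for c t
    unfolding S_def[abs_def]
    by (rule DERIV_cong[OF DERIV_fun_powr[where g = s and x = t and m = "2 * X t * a", OF ds s0]]) simp
  have dw: "(w has_real_derivative w1 t) (at t)" for t
    unfolding w_def w1_def by (rule derivative_eq_intros dS dY refl | simp)+
  have dW: "(W c has_real_derivative c * W (c - 1) t * w1 t) (at t)" for c t
    unfolding W_def[abs_def]
    by (rule DERIV_cong[OF DERIV_fun_powr[where g = w and x = t and m = "w1 t", OF dw w0]]) simp
  have dw1: "(w1 has_real_derivative w2 t) (at t)" for t
    unfolding w1_def w2_def
    by (rule derivative_eq_intros dS dX dY refl)+ (simp add: algebra_simps power2_eq_square)
  have dF: "(F has_real_derivative F1 t) (at t)" for t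
    unfolding F_def F1_def
    by (rule derivative_eq_intros dW ds refl)+ (simp add: algebra_simps)
  have dF1: "(F1 has_real_derivative F2 t) (at t)" for t
    unfolding F1_def F2_def
    by (rule derivative_eq_intros dW dw1 ds dX refl)+ (simp add: algebra_simps power2_eq_square)
  have F2: "F2 t \<ge> 2 * \<bar>a * b\<bar>" for t
  proof -
    define \<tau> where "\<tau> = w t powr \<beta>"
    define k where "k = s t powr (r - 2)"
    have k1: "S (r - 1) t = k * s t" and k2: "S r t = k * (s t)\<^sup>2" and k3: "S (r - 2) t = k"
      using s0[of t] by (simp_all add: S_def k_def powr_diff power2_eq_square)
    have \<tau>0: "\<tau> > 0" using w0[of t] by (simp add: \<tau>_def)
    have \<tau>2: "w t powr \<beta> * w t powr \<beta> = w t powr (2 * \<beta>)" by (simp flip: powr_add)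
    have t1: "W (\<gamma> - 1) t = 1 / \<tau>" "W (\<gamma> - 2) t = 1 / (\<tau> * w t)"
      "W (\<beta> - 1) t = \<tau> / w t" "W (\<beta> - 2) t = \<tau> / (w t)\<^sup>2" "W \<beta> t = \<tau>"
      using w0[of t] by (simp_all add: W_def \<tau>_def \<gamma>\<beta> \<tau>2 powr_diff powr_minus field_simps power2_eq_square)
    \<comment> \<open>\<open>s powr r <= w\<close> bounds \<open>s\<close> by
      \<open>w powr (1 / r)\<close>, and \<open>\<beta>\<close> is the exponent for which
      \<open>1 / r + 2 * \<beta> = 1\<close>; hence \<open>s * \<tau>^2 <= w\<close>.\<close>
    have "s t = (s t powr r) powr (1 / r)" using s0[of t] r by (simp add: powr_powr)
    also have "\<dots> \<le> w t powr (1 / r)" using r by (intro powr_mono2) (auto simp: w_def S_def)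
    finally have "s t * \<tau>\<^sup>2 \<le> w t powr (1 / r) * \<tau>\<^sup>2" by (intro mult_right_mono) auto
    also have "\<dots> = w t powr (1 / r + (\<beta> + \<beta>))" by (simp only: \<tau>_def power2_eq_square powr_add)
    also have "1 / r + (\<beta> + \<beta>) = 1" using r by (simp add: \<beta>_def field_simps)
    finally have st: "s t * \<tau>\<^sup>2 \<le> w t" using w0[of t] by simp
    have gb: "\<gamma> - 1 = - \<beta>" "\<beta> - 1 = - \<gamma>" using \<gamma>\<beta> by simp_all
    have k0: "k > 0" using s0[of t] by (simp add: k_def)
    have X2: "(X t)\<^sup>2 \<le> s t" using \<eta> by (simp add: s_def)
    have wk: "w t = k * (s t)\<^sup>2 + (Y t)\<^sup>2" by (simp add: w_def k2)
    have w1: "w1 t = 2 * r * k * s t * X t * a + 2 * Y t * b"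
      by (simp add: w1_def k1 mult.assoc)
    have w2: "w2 t = 4 * r * (r - 1) * k * (X t)\<^sup>2 * a\<^sup>2 + 2 * r * k * s t * a\<^sup>2 + 2 * b\<^sup>2"
      by (simp add: w2_def k1 k3 mult.assoc)
    have "2 * \<bar>a * b\<bar> \<le> 16 * r * (\<gamma> * w2 t / \<tau> - \<gamma> * \<beta> * (w1 t)\<^sup>2 / (\<tau> * w t)) + 2 * a\<^sup>2 * \<tau> + 4 * X t * a * \<beta> * \<tau> / w t * w1 t
      + s t * \<beta> * \<tau> / w t * w2 t - s t * \<beta> * \<gamma> * \<tau> / (w t)\<^sup>2 * (w1 t)\<^sup>2"
      unfolding w1 w2 \<beta>_def \<gamma>_def using r s0[of t] X2 k0 wk \<tau>0 st by (rule bellman_hessian_ge)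
    also have "\<dots> = F2 t"
      unfolding F2_def t1 unfolding gb by (simp add: algebra_simps power2_eq_square)
    finally show ?thesis .
  qed
  have F: "F t = bellman r \<eta> (x + t * a) (y + t * b)" for t
    by (simp only: F_def W_def w_def S_def s_def X_def Y_def bellman_def Let_def \<beta>_def \<gamma>_def)
  have "F 1 + F (-1) - 2 * F 0 \<ge> 2 * \<bar>a * b\<bar>"
    by (rule second_difference_ge[OF dF dF1 F2])
  then show ?thesis by (simp add: F)
qed

lemma bellman_midpoint:
  fixes r x y a b :: real
  assumes r: "r \<ge> 1"
  shows "bellman r 0 (x + a) (y + b) + bellman r 0 (x - a) (y - b)
    \<ge> 2 * bellman r 0 x y + 2 * \<bar>a * b\<bar>"
proof -
  have lim: "((\<lambda>\<eta>. bellman r \<eta> x y) \<longlongrightarrow> bellman r 0 x y) (at_right 0)" for x y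
  \<comment> \<open>For \<open>r = 1\<close> the exponent of the second summand is 0, and
    \<open>powr\<close> with exponent 0 jumps at base 0, where \<open>0 powr 0 = 0\<close>. The jump
    is harmless because \<open>w = 0\<close> forces the factor \<open>s\<close> to vanish as
    well.\<close>
  proof (cases "r = 1")
    case True
    have eq: "bellman 1 \<eta> x y = 16 * (x\<^sup>2 + \<eta> + y\<^sup>2) + (x\<^sup>2 + \<eta>)" if "\<eta> \<ge> 0" for \<eta>
    proof -
      have "x\<^sup>2 + \<eta> = 0" if "x\<^sup>2 + \<eta> + y\<^sup>2 = 0"
        using that \<open>\<eta> \<ge> 0\<close> by (smt (verit) zero_le_power2)
      then show ?thesis using that by (auto simp: bellman_def Let_def)
    qed
    have "((\<lambda>\<eta>. 16 * (x\<^sup>2 + \<eta> + y\<^sup>2) + (x\<^sup>2 + \<eta>)) \<longlongrightarrow> bellman 1 0 x y) (at_right 0)"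
      unfolding eq[OF order_refl] by (intro tendsto_intros)
    then show ?thesis unfolding True
      by (rule Lim_transform_eventually) (auto simp: eventually_at_filter eq)
  next
    case False
    then show ?thesis unfolding bellman_def Let_def using r
      by (intro tendsto_intros tendsto_powr2)
         (auto intro!: tendsto_eq_intros eventually_at_right_less always_eventually simp: eventually_at_filter)
  qed
  show ?thesis
    by (rule tendsto_le[OF _ tendsto_add[OF lim lim] tendsto_add[OF tendsto_mult[OF tendsto_const lim] tendsto_const]])
       (auto simp: eventually_at_filter intro!: always_eventually bellman_midpoint_pos[OF r])
qed

lemma bellman_nonneg: "r \<ge> 1 \<Longrightarrow> 0 \<le> bellman r 0 x y"
  by (simp add: bellman_def Let_def)

text \<open>Both summands of \<open>bellman\<close> are controlled by
  \<open>w powr \<gamma>\<close>, because \<open>x^2 <= w powr (1 / r)\<close>. As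
  \<open>\<gamma> <= 1\<close>, this power is subadditive, and the two parts of \<open>w\<close>
  produce the conjugate exponents \<open>r + 1\<close> and \<open>(r + 1) / r\<close>.\<close>

lemma bellman_le:
  assumes r: "r \<ge> 1"
  shows "bellman r 0 x y \<le> (16 * r + 1) * (\<bar>x\<bar> powr (r + 1) + \<bar>y\<bar> powr ((r + 1) / r))"
proof -
  define \<gamma> where "\<gamma> = (r + 1) / (2 * r)"
  define w where "w = (x\<^sup>2) powr r + y\<^sup>2"
  have \<gamma>: "0 < \<gamma>" "\<gamma> \<le> 1" using r by (auto simp: \<gamma>_def field_simps)
  have w0: "w \<ge> 0" by (simp add: w_def)
  have "x\<^sup>2 = ((x\<^sup>2) powr r) powr (1 / r)" using r by (simp add: powr_powr)
  also have "\<dots> \<le> w powr (1 / r)" using r by (intro powr_mono2) (auto simp: w_def)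
  finally have "x\<^sup>2 * w powr ((r - 1) / (2 * r)) \<le> w powr (1 / r) * w powr ((r - 1) / (2 * r))"
    by (intro mult_right_mono) auto
  also have "\<dots> = w powr \<gamma>" unfolding powr_add[symmetric] \<gamma>_def using r
    by (intro arg_cong[of _ _ "\<lambda>z. w powr z"]) (simp add: field_simps)
  finally have "bellman r 0 x y \<le> (16 * r + 1) * w powr \<gamma>"
    by (simp add: bellman_def Let_def w_def[symmetric] \<gamma>_def[symmetric] distrib_right)
  also have "w powr \<gamma> \<le> ((x\<^sup>2) powr r) powr \<gamma> + (y\<^sup>2) powr \<gamma>"
  proof (cases "w = 0")
    case False
    define A where "A = (x\<^sup>2) powr r" define B where "B = y\<^sup>2"
    have AB: "0 \<le> A" "0 \<le> B" "w = A + B" "w > 0" using False w0 by (simp_all add: A_def B_def w_def[symmetric])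
    \<comment> \<open>Subadditivity by normalization: \<open>A / w\<close> and \<open>B / w\<close>
      add up to 1, and an exponent at most 1 does not decrease them.\<close>
    have "t \<le> t powr \<gamma>" if "0 \<le> t" "t \<le> 1" for t::real
      using powr_mono'[OF \<gamma>(2) that] that by simp
    from this[of "A / w"] this[of "B / w"] have "A / w + B / w \<le> (A / w) powr \<gamma> + (B / w) powr \<gamma>"
      using AB by (intro add_mono) auto
    moreover have "A / w + B / w = 1" using AB by (simp flip: add_divide_distrib)
    ultimately have "w powr \<gamma> * 1 \<le> w powr \<gamma> * ((A / w) powr \<gamma> + (B / w) powr \<gamma>)"
      by (intro mult_left_mono) auto
    also have "\<dots> = A powr \<gamma> + B powr \<gamma>" using AB by (simp add: powr_divide distrib_left)
    finally show ?thesis by (simp add: A_def B_def)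
  qed simp
  also have "((x\<^sup>2) powr r) powr \<gamma> = \<bar>x\<bar> powr (r + 1)"
  proof -
    have "(x\<^sup>2) = \<bar>x\<bar> powr 2" by simp
    then show ?thesis using r by (simp only: powr_powr) (simp add: \<gamma>_def)
  qed
  also have "(y\<^sup>2) powr \<gamma> = \<bar>y\<bar> powr ((r + 1) / r)"
  proof -
    have "2 * \<gamma> = (r + 1) / r" using r by (simp add: \<gamma>_def field_simps)
    moreover have "(y\<^sup>2) = \<bar>y\<bar> powr 2" by simp
    ultimately show ?thesis by (simp only: powr_powr)
  qed
  finally show ?thesis using r by simp
qed

lemma bellman_measurable [measurable]: "(\<lambda>z. bellman r 0 (fst z) (snd z)) \<in> borel_measurable borel"
  unfolding bellman_def Let_def borel_prod[symmetric] by measurable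

text \<open>The gain \<open>2 * \<bar>a * b\<bar>\<close> over midpoint convexity is what dominates the pairing of the
  differences of two functions along the random walk.\<close>

definition zigzag_convex :: "(real \<Rightarrow> real \<Rightarrow> real) \<Rightarrow> bool" where
  "zigzag_convex \<Phi> \<longleftrightarrow> (\<lambda>z. \<Phi> (fst z) (snd z)) \<in> borel_measurable borel \<and> (\<forall>x y. 0 \<le> \<Phi> x y) \<and>
     (\<forall>x y a b. \<Phi> (x + a) (y + b) + \<Phi> (x - a) (y - b) \<ge> 2 * \<Phi> x y + 2 * \<bar>a * b\<bar>)"

text \<open>For \<open>p >= 2\<close> the choice is \<open>r = p - 1\<close>. For
  \<open>p < 2\<close> the conjugate exponent is at least 2 and the two arguments are exchanged, to
  which the gain \<open>\<bar>a * b\<bar>\<close> is insensitive.\<close>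

lemma zigzag_convex_exists:
  fixes p q :: real
  assumes p: "1 < p" and q: "q = p / (p - 1)"
  obtains \<Phi> C where "zigzag_convex \<Phi>" "C > 0"
    "\<And>x y. \<Phi> x y \<le> C * (\<bar>x\<bar> powr p + \<bar>y\<bar> powr q)"
proof (cases "p \<ge> 2")
  case True
  then have r: "p - 1 \<ge> 1" by simp
  show ?thesis
  proof (rule that)
    show "zigzag_convex (bellman (p - 1) 0)" unfolding zigzag_convex_def
      by (intro conjI allI bellman_measurable bellman_nonneg[OF r] bellman_midpoint[OF r])
    show "16 * (p - 1) + 1 > 0" using r by simp
    show "bellman (p - 1) 0 x y \<le> (16 * (p - 1) + 1) * (\<bar>x\<bar> powr p + \<bar>y\<bar> powr q)" for x y
      using bellman_le[OF r, of x y] by (simp only: q diff_add_cancel)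
  qed
next
  case False
  then have r: "q - 1 \<ge> 1" using p by (simp add: q field_simps)
  have pq: "q / (q - 1) = p" using p by (simp add: q field_simps)
  have meas: "(\<lambda>z. bellman (q - 1) 0 (snd z) (fst z)) \<in> borel_measurable (borel :: (real \<times> real) measure)"
    unfolding bellman_def Let_def borel_prod[symmetric] by measurable
  have mid: "2 * bellman (q - 1) 0 y x + 2 * \<bar>a * b\<bar>
      \<le> bellman (q - 1) 0 (y + b) (x + a) + bellman (q - 1) 0 (y - b) (x - a)" for x y a b
    using bellman_midpoint[OF r, of y x b a] by (simp only: mult.commute)
  show ?thesis
  proof (rule that)
    show "zigzag_convex (\<lambda>x y. bellman (q - 1) 0 y x)" unfolding zigzag_convex_def
      by (intro conjI allI meas bellman_nonneg[OF r] mid)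
    show "16 * (q - 1) + 1 > 0" using r by simp
    show "bellman (q - 1) 0 y x \<le> (16 * (q - 1) + 1) * (\<bar>x\<bar> powr p + \<bar>y\<bar> powr q)" for x y
      using bellman_le[OF r, of y x] by (simp only: pq diff_add_cancel) (simp add: add.commute)
  qed
qed

section \<open>Random walks\<close>

lemma nn_integral_lborel_translate:
  fixes f :: "'a::euclidean_space \<Rightarrow> ennreal"
  assumes [measurable]: "f \<in> borel_measurable borel"
  shows "(\<integral>\<^sup>+x. f (x + c) \<partial>lborel) = (\<integral>\<^sup>+x. f x \<partial>lborel)"
proof -
  have "(\<integral>\<^sup>+x. f x \<partial>lborel) = (\<integral>\<^sup>+x. f x \<partial>distr lborel borel ((+) c))"
    by (simp add: lborel_distr_plus)
  also have "\<dots> = (\<integral>\<^sup>+x. f (c + x) \<partial>lborel)" by (subst nn_integral_distr) auto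
  finally show ?thesis by (simp add: add.commute)
qed

lemma
  fixes f :: "'a::euclidean_space \<Rightarrow> real"
  assumes "integrable lborel f"
  shows integrable_lborel_translate: "integrable lborel (\<lambda>x. f (x + c))"
    and integral_lborel_translate: "(LINT x|lborel. f (x + c)) = (LINT x|lborel. f x)"
proof -
  have "integrable (distr lborel borel ((+) c)) f" using assms by (simp add: lborel_distr_plus)
  then show "integrable lborel (\<lambda>x. f (x + c))"
    by (subst (asm) integrable_distr_eq) (use assms in \<open>auto simp: add.commute\<close>)
  have "(LINT x|distr lborel borel ((+) c). f x) = (LINT x|lborel. f (c + x))"
    by (subst integral_distr) (use assms in auto)
  then show "(LINT x|lborel. f (x + c)) = (LINT x|lborel. f x)"
    by (simp add: lborel_distr_plus add.commute)
qed

section \<open>Averages and differences as operators on functions\<close>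

definition avg :: "'a::euclidean_space \<Rightarrow> ('a \<Rightarrow> real) \<Rightarrow> 'a \<Rightarrow> real" where
  "avg w f x = (f (x + w) + f (x - w)) / 2"

definition dif :: "'a::euclidean_space \<Rightarrow> ('a \<Rightarrow> real) \<Rightarrow> 'a \<Rightarrow> real" where
  "dif w f x = (f (x + w) - f (x - w)) / 2"

text \<open>One step of the walk moves independently by plus or minus each listed direction: a
  composition of commuting averages, not their mean. Any direction can thus be applied first, and
  its gain is collected while the other averages do not increase the energy.\<close>

primrec avgs :: "'a::euclidean_space list \<Rightarrow> ('a \<Rightarrow> real) \<Rightarrow> 'a \<Rightarrow> real" where
  "avgs [] f = f"
| "avgs (w # ws) f = avg w (avgs ws f)"

lemma avg_commute: "avg v (avg w f) = avg w (avg v f)"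
  by (rule ext) (simp add: avg_def field_simps)

lemma dif_avg_commute: "dif v (avg w f) = avg w (dif v f)"
  by (rule ext) (simp add: avg_def dif_def field_simps)

lemma avgs_avg_commute: "avgs ws (avg w f) = avg w (avgs ws f)"
  by (induction ws) (simp_all add: avg_commute)

lemma dif_avgs_commute: "dif w (avgs ws f) = avgs ws (dif w f)"
  by (induction ws) (simp_all add: dif_avg_commute)

lemma avgs_remove1: "w \<in> set ws \<Longrightarrow> avgs ws f = avgs (remove1 w ws) (avg w f)"
  by (induction ws) (auto simp: avgs_avg_commute avg_commute)

lemma dif_walk_commute: "dif w ((avgs ws ^^ m) f) = (avgs ws ^^ m) (dif w f)"
  by (induction m) (simp_all add: dif_avgs_commute)

lemma avg_diff: "avg w (\<lambda>x. f x - g x) = (\<lambda>x. avg w f x - avg w g x)"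
  by (rule ext) (simp add: avg_def field_simps)

lemma avgs_diff: "avgs ws (\<lambda>x. f x - g x) = (\<lambda>x. avgs ws f x - avgs ws g x)"
  by (induction ws) (simp_all add: avg_diff)

lemma walk_diff: "(avgs ws ^^ m) (\<lambda>x. f x - g x) = (\<lambda>x. (avgs ws ^^ m) f x - (avgs ws ^^ m) g x)"
  by (induction m) (simp_all add: avgs_diff)

lemma dif_diff: "dif w (\<lambda>x. f x - g x) = (\<lambda>x. dif w f x - dif w g x)"
  by (rule ext) (simp add: dif_def field_simps)

lemma avg_measurable [measurable]:
  assumes [measurable]: "f \<in> borel_measurable borel"
  shows "avg w f \<in> borel_measurable borel"
  unfolding avg_def[abs_def] by measurable

lemma dif_measurable [measurable]:
  assumes [measurable]: "f \<in> borel_measurable borel"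
  shows "dif w f \<in> borel_measurable borel"
  unfolding dif_def[abs_def] by measurable

lemma avgs_measurable [measurable]:
  "f \<in> borel_measurable borel \<Longrightarrow> avgs ws f \<in> borel_measurable borel"
  by (induction ws) auto

lemma walk_measurable [measurable]:
  "f \<in> borel_measurable borel \<Longrightarrow> (avgs ws ^^ m) f \<in> borel_measurable borel"
  by (induction m) auto

text \<open>The class of left factors in the pairings. It is stable under averages and differences,
  and against an integrable right factor every product is integrable.\<close>

definition bdd_measurable :: "('a::euclidean_space \<Rightarrow> real) \<Rightarrow> bool" where
  "bdd_measurable f \<longleftrightarrow> f \<in> borel_measurable borel \<and> (\<exists>B. \<forall>x. \<bar>f x\<bar> \<le> B)"

lemma bdd_measurable_avg: "bdd_measurable f \<Longrightarrow> bdd_measurable (avg w f)"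
proof -
  assume "bdd_measurable f"
  then obtain B where [measurable]: "f \<in> borel_measurable borel" and B: "\<And>x. \<bar>f x\<bar> \<le> B"
    by (auto simp: bdd_measurable_def)
  have "\<bar>avg w f x\<bar> \<le> B" for x using B[of "x + w"] B[of "x - w"] by (auto simp: avg_def)
  then show ?thesis by (auto simp: bdd_measurable_def)
qed

lemma bdd_measurable_dif: "bdd_measurable f \<Longrightarrow> bdd_measurable (dif w f)"
proof -
  assume "bdd_measurable f"
  then obtain B where [measurable]: "f \<in> borel_measurable borel" and B: "\<And>x. \<bar>f x\<bar> \<le> B"
    by (auto simp: bdd_measurable_def)
  have "\<bar>dif w f x\<bar> \<le> B" for x using B[of "x + w"] B[of "x - w"] by (auto simp: dif_def)
  then show ?thesis by (auto simp: bdd_measurable_def)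
qed

lemma bdd_measurable_diff: "bdd_measurable f \<Longrightarrow> bdd_measurable g \<Longrightarrow> bdd_measurable (\<lambda>x. f x - g x)"
proof -
  assume "bdd_measurable f" "bdd_measurable g"
  then obtain B C where [measurable]: "f \<in> borel_measurable borel" "g \<in> borel_measurable borel"
    and B: "\<And>x. \<bar>f x\<bar> \<le> B" and C: "\<And>x. \<bar>g x\<bar> \<le> C"
    by (auto simp: bdd_measurable_def)
  have "\<bar>f x - g x\<bar> \<le> B + C" for x using B[of x] C[of x] by auto
  then show ?thesis by (auto simp: bdd_measurable_def)
qed

lemma bdd_measurable_avgs: "bdd_measurable f \<Longrightarrow> bdd_measurable (avgs ws f)"
  by (induction ws) (auto intro: bdd_measurable_avg)

lemma bdd_measurable_walk: "bdd_measurable f \<Longrightarrow> bdd_measurable ((avgs ws ^^ m) f)"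
  by (induction m) (auto intro: bdd_measurable_avgs)

lemma integrable_lborel_translate_minus:
  fixes f :: "'a::euclidean_space \<Rightarrow> real"
  shows "integrable lborel f \<Longrightarrow> integrable lborel (\<lambda>x. f (x - c))"
  using integrable_lborel_translate[of f "- c"] by simp

lemma integrable_avg: "integrable lborel f \<Longrightarrow> integrable lborel (avg w f)"
  unfolding avg_def[abs_def]
  by (intro integrable_divide Bochner_Integration.integrable_add integrable_lborel_translate
      integrable_lborel_translate_minus)

lemma integrable_dif: "integrable lborel f \<Longrightarrow> integrable lborel (dif w f)"
  unfolding dif_def[abs_def]
  by (intro integrable_divide Bochner_Integration.integrable_diff integrable_lborel_translate
      integrable_lborel_translate_minus)

lemma integrable_avgs: "integrable lborel f \<Longrightarrow> integrable lborel (avgs ws f)"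
  by (induction ws) (auto intro: integrable_avg)

lemma integrable_walk: "integrable lborel f \<Longrightarrow> integrable lborel ((avgs ws ^^ m) f)"
  by (induction m) (auto intro: integrable_avgs)

lemma integrable_bdd_mult:
  assumes "bdd_measurable f" "integrable lborel h"
  shows "integrable lborel (\<lambda>x. f x * h x)"
proof -
  obtain B where [measurable]: "f \<in> borel_measurable borel" and B: "\<And>x. \<bar>f x\<bar> \<le> B"
    using assms(1) by (auto simp: bdd_measurable_def)
  have [measurable]: "h \<in> borel_measurable borel" using assms(2) by auto
  show ?thesis
  proof (rule Bochner_Integration.integrable_bound)
    show "integrable lborel (\<lambda>x. B * \<bar>h x\<bar>)" using assms(2) by auto
    show "AE x in lborel. norm (f x * h x) \<le> norm (B * \<bar>h x\<bar>)"
      using B by (intro AE_I2) (auto simp: abs_mult intro!: mult_right_mono intro: order_trans[OF _ abs_ge_self])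
  qed auto
qed

lemma bdd_measurable_translate: "bdd_measurable f \<Longrightarrow> bdd_measurable (\<lambda>x. f (x + c))"
  by (auto simp: bdd_measurable_def)

lemma bdd_measurable_translate_minus: "bdd_measurable f \<Longrightarrow> bdd_measurable (\<lambda>x. f (x - c))"
  by (auto simp: bdd_measurable_def)

lemma integral_translate_mult:
  assumes "bdd_measurable f" "integrable lborel h"
  shows "(LINT x|lborel. f (x + c) * h x) = (LINT x|lborel. f x * h (x - c))"
proof -
  have "(LINT x|lborel. f x * h (x - c)) = (LINT x|lborel. f (x + c) * h (x + c - c))"
    by (rule integral_lborel_translate[symmetric])
       (intro integrable_bdd_mult integrable_lborel_translate_minus assms)
  then show ?thesis by simp
qed

text \<open>Translation invariance moves a shift by \<open>w\<close> from one factor to a shift by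
  \<open>- w\<close> of the other. This exchanges the two terms, so \<open>avg\<close> is
  self-adjoint and \<open>dif\<close> changes sign.\<close>

lemma
  assumes f: "bdd_measurable f" and h: "integrable lborel h"
  shows integral_avg_mult: "(LINT x|lborel. avg w f x * h x) = (LINT x|lborel. f x * avg w h x)"
    and integral_dif_mult: "(LINT x|lborel. dif w f x * h x) = - (LINT x|lborel. f x * dif w h x)"
proof -
  have i: "integrable lborel (\<lambda>x. f (x + w) * h x)" "integrable lborel (\<lambda>x. f (x - w) * h x)"
    "integrable lborel (\<lambda>x. f x * h (x + w))" "integrable lborel (\<lambda>x. f x * h (x - w))"
    by (intro integrable_bdd_mult bdd_measurable_translate bdd_measurable_translate_minus f h
        integrable_lborel_translate integrable_lborel_translate_minus)+
  have t: "(LINT x|lborel. f (x + w) * h x) = (LINT x|lborel. f x * h (x - w))"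
    "(LINT x|lborel. f (x - w) * h x) = (LINT x|lborel. f x * h (x + w))"
    using integral_translate_mult[OF f h, of w] integral_translate_mult[OF f h, of "- w"] by auto
  show "(LINT x|lborel. avg w f x * h x) = (LINT x|lborel. f x * avg w h x)"
    using i t by (simp add: avg_def distrib_left distrib_right add_divide_distrib)
  show "(LINT x|lborel. dif w f x * h x) = - (LINT x|lborel. f x * dif w h x)"
    using i t by (simp add: dif_def left_diff_distrib right_diff_distrib diff_divide_distrib)
qed

lemma integral_avgs_mult:
  assumes f: "bdd_measurable f" and h: "integrable lborel h"
  shows "(LINT x|lborel. avgs ws f x * h x) = (LINT x|lborel. f x * avgs ws h x)"
  using h
proof (induction ws arbitrary: h)
  case (Cons w ws)
  then show ?case
    by (simp add: integral_avg_mult bdd_measurable_avgs f integrable_avg avgs_avg_commute)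
qed simp

lemma integral_walk_mult:
  assumes f: "bdd_measurable f" and h: "integrable lborel h"
  shows "(LINT x|lborel. (avgs ws ^^ m) f x * h x) = (LINT x|lborel. f x * (avgs ws ^^ m) h x)"
  using h
proof (induction m arbitrary: h)
  case (Suc m)
  have "(LINT x|lborel. (avgs ws ^^ Suc m) f x * h x) = (LINT x|lborel. (avgs ws ^^ m) f x * avgs ws h x)"
    by (simp add: integral_avgs_mult bdd_measurable_walk f Suc.prems)
  also have "\<dots> = (LINT x|lborel. f x * (avgs ws ^^ m) (avgs ws h) x)"
    by (rule Suc.IH) (rule integrable_avgs[OF Suc.prems])
  finally show ?case by (simp add: funpow_swap1)
qed simp

section \<open>Energy decrease along the walk\<close>

lemma zigzag_convex_measurable:
  assumes "zigzag_convex \<Phi>" "u \<in> borel_measurable M" "v \<in> borel_measurable M"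
  shows "(\<lambda>x. \<Phi> (u x) (v x)) \<in> borel_measurable M"
proof -
  have "(\<lambda>x. (u x, v x)) \<in> measurable M borel" using assms(2,3) by (rule borel_measurable_Pair)
  moreover have "(\<lambda>z. \<Phi> (fst z) (snd z)) \<in> borel_measurable borel"
    using assms(1) by (simp add: zigzag_convex_def)
  ultimately show ?thesis by (auto dest: measurable_compose)
qed

text \<open>Midpoint convexity is used at the point \<open>(avg w u x, avg w v x)\<close> with
  displacement \<open>(dif w u x, dif w v x)\<close>, whose end points are the values of
  \<open>(u, v)\<close> at \<open>x + w\<close> and \<open>x - w\<close>. Translation invariance
  merges the two resulting integrals.\<close>

lemma zigzag_avg:
  assumes \<Phi>: "zigzag_convex \<Phi>"
    and u[measurable]: "u \<in> borel_measurable borel" and v[measurable]: "v \<in> borel_measurable borel"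
  shows "(\<integral>\<^sup>+x. ennreal (\<Phi> (avg w u x) (avg w v x)) \<partial>lborel)
      + (\<integral>\<^sup>+x. ennreal \<bar>dif w u x * dif w v x\<bar> \<partial>lborel)
    \<le> (\<integral>\<^sup>+x. ennreal (\<Phi> (u x) (v x)) \<partial>lborel)"
proof -
  note m = zigzag_convex_measurable[OF \<Phi>]
  have pos: "0 \<le> \<Phi> x y" for x y using \<Phi> by (simp add: zigzag_convex_def)
  have [measurable]: "(\<lambda>x. \<Phi> (u x) (v x)) \<in> borel_measurable borel"
    "(\<lambda>x. \<Phi> (avg w u x) (avg w v x)) \<in> borel_measurable borel"
    "(\<lambda>x. \<Phi> (u (x + w)) (v (x + w))) \<in> borel_measurable borel"
    "(\<lambda>x. \<Phi> (u (x - w)) (v (x - w))) \<in> borel_measurable borel"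
    by (rule m; measurable)+
  let ?h = "\<lambda>x. ennreal (\<Phi> (u x) (v x) / 2)"
  have "(\<integral>\<^sup>+x. ennreal (\<Phi> (avg w u x) (avg w v x)) \<partial>lborel)
      + (\<integral>\<^sup>+x. ennreal \<bar>dif w u x * dif w v x\<bar> \<partial>lborel)
      = (\<integral>\<^sup>+x. ennreal (\<Phi> (avg w u x) (avg w v x) + \<bar>dif w u x * dif w v x\<bar>) \<partial>lborel)"
    by (subst nn_integral_add[symmetric]) (auto simp: pos)
  also have "\<dots> \<le> (\<integral>\<^sup>+x. ?h (x + w) + ?h (x - w) \<partial>lborel)"
  proof (rule nn_integral_mono)
    fix x
    have "\<Phi> (avg w u x + dif w u x) (avg w v x + dif w v x) + \<Phi> (avg w u x - dif w u x) (avg w v x - dif w v x)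
      \<ge> 2 * \<Phi> (avg w u x) (avg w v x) + 2 * \<bar>dif w u x * dif w v x\<bar>"
      using \<Phi> by (simp add: zigzag_convex_def)
    moreover have "avg w f x + dif w f x = f (x + w)" "avg w f x - dif w f x = f (x - w)" for f
      by (simp_all add: avg_def dif_def field_simps)
    ultimately show "ennreal (\<Phi> (avg w u x) (avg w v x) + \<bar>dif w u x * dif w v x\<bar>) \<le> ?h (x + w) + ?h (x - w)"
      by (simp add: pos flip: ennreal_plus)
  qed
  also have "\<dots> = (\<integral>\<^sup>+x. ?h (x + w) \<partial>lborel) + (\<integral>\<^sup>+x. ?h (x + (- w)) \<partial>lborel)"
    by (subst nn_integral_add) auto
  also have "\<dots> = (\<integral>\<^sup>+x. ?h x \<partial>lborel) + (\<integral>\<^sup>+x. ?h x \<partial>lborel)"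
    by (intro arg_cong2[of _ _ _ _ "(+)"] nn_integral_lborel_translate) measurable
  also have "\<dots> = (\<integral>\<^sup>+x. ennreal (\<Phi> (u x) (v x)) \<partial>lborel)"
    by (subst nn_integral_add[symmetric]) (auto simp: pos simp flip: ennreal_plus)
  finally show ?thesis .
qed

lemma zigzag_avgs:
  assumes \<Phi>: "zigzag_convex \<Phi>"
    and u[measurable]: "u \<in> borel_measurable borel" and v[measurable]: "v \<in> borel_measurable borel"
  shows "(\<integral>\<^sup>+x. ennreal (\<Phi> (avgs ws u x) (avgs ws v x)) \<partial>lborel)
    \<le> (\<integral>\<^sup>+x. ennreal (\<Phi> (u x) (v x)) \<partial>lborel)"
proof (induction ws)
  case (Cons w ws)
  have "(\<integral>\<^sup>+x. ennreal (\<Phi> (avgs (w # ws) u x) (avgs (w # ws) v x)) \<partial>lborel)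
      \<le> (\<integral>\<^sup>+x. ennreal (\<Phi> (avgs ws u x) (avgs ws v x)) \<partial>lborel)"
    by (rule order_trans[OF _ zigzag_avg[OF \<Phi>, of "avgs ws u" "avgs ws v" w]]) simp_all
  also note Cons.IH
  finally show ?case .
qed simp

text \<open>The energy \<open>I m\<close> after \<open>m\<close> steps satisfies
  \<open>I (Suc m) + d m <= I m\<close>, and \<open>I\<close> stays nonnegative, so the released
  amounts \<open>d m\<close> sum to at most \<open>I 0\<close>.\<close>

lemma zigzag_walk_sum:
  assumes \<Phi>: "zigzag_convex \<Phi>" and w: "w \<in> set ws"
    and u[measurable]: "u \<in> borel_measurable borel" and v[measurable]: "v \<in> borel_measurable borel"
  shows "(\<Sum>m<M. \<integral>\<^sup>+x. ennreal \<bar>dif w ((avgs ws ^^ m) u) x * dif w ((avgs ws ^^ m) v) x\<bar> \<partial>lborel)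
    \<le> (\<integral>\<^sup>+x. ennreal (\<Phi> (u x) (v x)) \<partial>lborel)"
proof -
  define I where "I m = (\<integral>\<^sup>+x. ennreal (\<Phi> ((avgs ws ^^ m) u x) ((avgs ws ^^ m) v x)) \<partial>lborel)" for m
  define d where "d m = (\<integral>\<^sup>+x. ennreal \<bar>dif w ((avgs ws ^^ m) u) x * dif w ((avgs ws ^^ m) v) x\<bar> \<partial>lborel)" for m
  have step: "I (Suc m) + d m \<le> I m" for m
  proof -
    let ?u = "(avgs ws ^^ m) u" and ?v = "(avgs ws ^^ m) v"
    \<comment> \<open>The average in direction \<open>w\<close> is pulled out to act first; the
      remaining directions can only lower the energy.\<close>
    have "I (Suc m) \<le> (\<integral>\<^sup>+x. ennreal (\<Phi> (avg w ?u x) (avg w ?v x)) \<partial>lborel)"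
      unfolding I_def using zigzag_avgs[OF \<Phi>, of "avg w ?u" "avg w ?v" "remove1 w ws"]
      by (simp add: avgs_remove1[OF w, symmetric])
    then have "I (Suc m) + d m \<le> (\<integral>\<^sup>+x. ennreal (\<Phi> (avg w ?u x) (avg w ?v x)) \<partial>lborel) + d m"
      by (rule add_right_mono)
    also have "\<dots> \<le> I m" unfolding d_def I_def by (rule zigzag_avg[OF \<Phi>]) measurable
    finally show ?thesis .
  qed
  have "I M + (\<Sum>m<M. d m) \<le> I 0"
  proof (induction M)
    case (Suc M)
    have "I (Suc M) + (\<Sum>m<Suc M. d m) = (I (Suc M) + d M) + (\<Sum>m<M. d m)" by (simp add: ac_simps)
    also have "\<dots> \<le> I M + (\<Sum>m<M. d m)" by (rule add_right_mono[OF step])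
    also note Suc.IH
    finally show ?case .
  qed simp
  then have "(\<Sum>m<M. d m) \<le> I 0" by (rule order_trans[rotated]) simp
  then show ?thesis by (simp add: d_def I_def)
qed

text \<open>The energy argument with \<open>(x^2 + y^2) / 2\<close> and both functions equal to
  \<open>g\<close>: the squared \<open>L^2\<close> norms of the differences have a sum of at most
  that of \<open>g\<close>, so they form a null sequence.\<close>

lemma walk_dif_L2_tendsto_0:
  fixes g :: "'a::euclidean_space \<Rightarrow> real"
  assumes w: "w \<in> set ws" and g: "g \<in> borel_measurable borel" "integrable lborel (\<lambda>x. (g x)\<^sup>2)"
  shows "integrable lborel (\<lambda>x. (dif w ((avgs ws ^^ m) g) x)\<^sup>2)"
    and "(\<lambda>m. LINT x|lborel. (dif w ((avgs ws ^^ m) g) x)\<^sup>2) \<longlonglongrightarrow> 0"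
proof -
  note [measurable] = g(1)
  have "(\<lambda>z. ((fst z)\<^sup>2 + (snd z)\<^sup>2) / 2) \<in> borel_measurable (borel :: (real \<times> real) measure)"
    unfolding borel_prod[symmetric] by measurable
  moreover have "((x + a)\<^sup>2 + (y + b)\<^sup>2) / 2 + ((x - a)\<^sup>2 + (y - b)\<^sup>2) / 2
      \<ge> 2 * ((x\<^sup>2 + y\<^sup>2) / 2) + 2 * \<bar>a * b\<bar>" for x y a b :: real
  proof -
    have "0 \<le> (\<bar>a\<bar> - \<bar>b\<bar>)\<^sup>2" by simp
    then have "2 * \<bar>a * b\<bar> \<le> a\<^sup>2 + b\<^sup>2" by (simp add: power2_diff abs_mult)
    then show ?thesis by (simp add: power2_eq_square field_simps)
  qed
  ultimately have zz: "zigzag_convex (\<lambda>x y. (x\<^sup>2 + y\<^sup>2) / 2)" by (auto simp: zigzag_convex_def)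
  have G: "(\<integral>\<^sup>+x. ennreal ((g x)\<^sup>2) \<partial>lborel) = ennreal (LINT x|lborel. (g x)\<^sup>2)"
    using g by (intro nn_integral_eq_integral) auto
  define d where "d m = (\<integral>\<^sup>+x. ennreal ((dif w ((avgs ws ^^ m) g) x)\<^sup>2) \<partial>lborel)" for m
  have sum: "(\<Sum>m<M. d m) \<le> ennreal (LINT x|lborel. (g x)\<^sup>2)" for M
    using zigzag_walk_sum[OF zz w g(1) g(1), of M] unfolding G[symmetric] by (simp add: d_def power2_eq_square)
  have "d m \<le> (\<Sum>m<Suc m. d m)" for m by simp
  then have d_fin: "d m < \<infinity>" for m
    using sum[of "Suc m"] by (metis ennreal_less_top infinity_ennreal_def order_le_less_trans)
  show int: "integrable lborel (\<lambda>x. (dif w ((avgs ws ^^ m) g) x)\<^sup>2)" for m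
    by (rule integrableI_nonneg) (use d_fin in \<open>auto simp: d_def\<close>)
  have d_eq: "d m = ennreal (LINT x|lborel. (dif w ((avgs ws ^^ m) g) x)\<^sup>2)" for m
    unfolding d_def by (intro nn_integral_eq_integral int) auto
  have "summable (\<lambda>m. LINT x|lborel. (dif w ((avgs ws ^^ m) g) x)\<^sup>2)"
  proof (rule summableI_nonneg_bounded)
    show "(\<Sum>m<M. LINT x|lborel. (dif w ((avgs ws ^^ m) g) x)\<^sup>2) \<le> (LINT x|lborel. (g x)\<^sup>2)" for M
      using sum[of M] by (simp add: d_eq sum_ennreal)
  qed auto
  then show "(\<lambda>m. LINT x|lborel. (dif w ((avgs ws ^^ m) g) x)\<^sup>2) \<longlonglongrightarrow> 0"
    by (rule summable_LIMSEQ_zero)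
qed

text \<open>Partial sums of the pairings telescope to \<open>?dd 0 - ?dd (2 * M)\<close> and are
  bounded by the initial energy; the remainder \<open>?dd (2 * M)\<close> is then shown to vanish.
  If the right-hand side is infinite, there is nothing to prove.\<close>

lemma second_difference_pairing:
  fixes g h :: "'a::euclidean_space \<Rightarrow> real"
  assumes \<Phi>: "zigzag_convex \<Phi>" and w: "w \<in> set ws"
    and g: "bdd_measurable g" "integrable lborel (\<lambda>x. (g x)\<^sup>2)"
    and h: "bdd_measurable h" "integrable lborel h"
  shows "ennreal \<bar>LINT x|lborel. dif w (dif w g) x * h x\<bar>
    \<le> (\<integral>\<^sup>+x. ennreal (\<Phi> (avgs ws (avgs ws g) x - g x) (h x)) \<partial>lborel)"
proof (cases "(\<integral>\<^sup>+x. ennreal (\<Phi> (avgs ws (avgs ws g) x - g x) (h x)) \<partial>lborel)" rule: ennreal_cases)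
  case (real N)
  let ?T = "avgs ws"
  define f where "f x = ?T (?T g) x - g x" for x
  have [measurable]: "g \<in> borel_measurable borel" "h \<in> borel_measurable borel"
    using g h by (auto simp: bdd_measurable_def)
  have f: "bdd_measurable f" unfolding f_def by (intro bdd_measurable_diff bdd_measurable_avgs g)
  have [measurable]: "f \<in> borel_measurable borel" using f by (simp add: bdd_measurable_def)
  let ?dd = "\<lambda>m. LINT x|lborel. dif w (dif w ((?T ^^ m) g)) x * h x"
  have pairing: "(LINT x|lborel. dif w ((?T ^^ m) f) x * dif w ((?T ^^ m) h) x) = ?dd (2 * m) - ?dd (2 * m + 2)" for m
  proof -
    have "(LINT x|lborel. dif w ((?T ^^ m) f) x * dif w ((?T ^^ m) h) x) =
       - (LINT x|lborel. dif w (dif w ((?T ^^ m) f)) x * (?T ^^ m) h x)"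
      by (subst (2) integral_dif_mult)
        (auto intro!: bdd_measurable_dif bdd_measurable_walk f h integrable_walk)
    also have "(LINT x|lborel. dif w (dif w ((?T ^^ m) f)) x * (?T ^^ m) h x)
       = (LINT x|lborel. (?T ^^ m) (dif w (dif w ((?T ^^ m) f))) x * h x)"
      by (rule integral_walk_mult[symmetric]) (auto intro!: bdd_measurable_dif bdd_measurable_walk f h)
    \<comment> \<open>The copy of \<open>T^m\<close> moved over from \<open>h\<close> joins the one
      on \<open>f\<close>, since \<open>T\<close> commutes with \<open>dif w\<close>.\<close>
    also have "(?T ^^ m) (dif w (dif w ((?T ^^ m) f))) = dif w (dif w ((?T ^^ (2 * m)) f))"
      by (simp add: dif_walk_commute[symmetric] funpow_add mult_2)
    also have "(?T ^^ (2 * m)) f = (\<lambda>x. (?T ^^ (2 * m + 2)) g x - (?T ^^ (2 * m)) g x)"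
    proof -
      have "(?T ^^ (2 * m + 2)) g = (?T ^^ (2 * m)) (?T (?T g))"
        by (simp only: funpow_add o_apply) (simp add: numeral_2_eq_2)
      then show ?thesis unfolding f_def[abs_def] walk_diff by simp
    qed
    also have "(LINT x|lborel. dif w (dif w (\<lambda>x. (?T ^^ (2 * m + 2)) g x - (?T ^^ (2 * m)) g x)) x * h x)
       = ?dd (2 * m + 2) - ?dd (2 * m)"
      unfolding dif_diff left_diff_distrib
      by (intro Bochner_Integration.integral_diff integrable_bdd_mult h bdd_measurable_dif bdd_measurable_walk g)
    finally show ?thesis by simp
  qed
  have tel: "(\<Sum>m<M. LINT x|lborel. dif w ((?T ^^ m) f) x * dif w ((?T ^^ m) h) x) = ?dd 0 - ?dd (2 * M)" for M
    unfolding pairing by (induction M) auto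
  have bound: "\<bar>?dd 0 - ?dd (2 * M)\<bar> \<le> N" for M
  proof -
    have i: "integrable lborel (\<lambda>x. \<bar>dif w ((?T ^^ m) f) x * dif w ((?T ^^ m) h) x\<bar>)" for m
      by (intro integrable_abs integrable_bdd_mult bdd_measurable_dif bdd_measurable_walk f integrable_dif integrable_walk h)
    have "ennreal (\<Sum>m<M. LINT x|lborel. \<bar>dif w ((?T ^^ m) f) x * dif w ((?T ^^ m) h) x\<bar>) =
        (\<Sum>m<M. \<integral>\<^sup>+x. ennreal \<bar>dif w ((?T ^^ m) f) x * dif w ((?T ^^ m) h) x\<bar> \<partial>lborel)"
    proof -
      have "(\<Sum>m<M. \<integral>\<^sup>+x. ennreal \<bar>dif w ((?T ^^ m) f) x * dif w ((?T ^^ m) h) x\<bar> \<partial>lborel) =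
          (\<Sum>m<M. ennreal (LINT x|lborel. \<bar>dif w ((?T ^^ m) f) x * dif w ((?T ^^ m) h) x\<bar>))"
        by (intro sum.cong refl nn_integral_eq_integral i) auto
      also have "\<dots> = ennreal (\<Sum>m<M. LINT x|lborel. \<bar>dif w ((?T ^^ m) f) x * dif w ((?T ^^ m) h) x\<bar>)"
        by (rule sum_ennreal) auto
      finally show ?thesis ..
    qed
    also have "\<dots> \<le> (\<integral>\<^sup>+x. ennreal (\<Phi> (f x) (h x)) \<partial>lborel)"
      by (rule zigzag_walk_sum[OF \<Phi> w]) measurable
    also have "\<dots> = ennreal N" using real by (simp add: f_def)
    finally have "(\<Sum>m<M. LINT x|lborel. \<bar>dif w ((?T ^^ m) f) x * dif w ((?T ^^ m) h) x\<bar>) \<le> N"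
      using real by (simp add: ennreal_le_iff)
    moreover have "\<bar>\<Sum>m<M. LINT x|lborel. dif w ((?T ^^ m) f) x * dif w ((?T ^^ m) h) x\<bar>
       \<le> (\<Sum>m<M. LINT x|lborel. \<bar>dif w ((?T ^^ m) f) x * dif w ((?T ^^ m) h) x\<bar>)"
      by (intro order_trans[OF sum_abs] sum_mono integral_abs_bound)
    ultimately show ?thesis using tel[of M] by linarith
  qed
  define k where "k m = (LINT x|lborel. (dif w ((?T ^^ m) g) x)\<^sup>2)" for m
  define H where "H = (LINT x|lborel. (dif w h x)\<^sup>2)"
  have k0: "k \<longlonglongrightarrow> 0" unfolding k_def[abs_def]
    by (rule walk_dif_L2_tendsto_0(2)[OF w]) (use g in auto)
  \<comment> \<open>Young's inequality with a free parameter stands in for Cauchy-Schwarz: for fixed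
    \<open>e\<close> the first term tends to 0 with \<open>m\<close>, and afterwards
    \<open>e\<close> is sent to 0.\<close>
  have rem: "\<bar>?dd m\<bar> \<le> k m / (2 * e) + e * H / 2" if e: "e > 0" for m e
  proof -
    have ik: "integrable lborel (\<lambda>x. (dif w ((?T ^^ m) g) x)\<^sup>2)"
      by (rule walk_dif_L2_tendsto_0(1)[OF w]) (use g in auto)
    have iH: "integrable lborel (\<lambda>x. (dif w h x)\<^sup>2)" unfolding power2_eq_square
      by (intro integrable_bdd_mult bdd_measurable_dif integrable_dif h)
    have ip: "integrable lborel (\<lambda>x. dif w ((?T ^^ m) g) x * dif w h x)"
      by (intro integrable_bdd_mult bdd_measurable_dif bdd_measurable_walk g integrable_dif h)
    have "?dd m = - (LINT x|lborel. dif w ((?T ^^ m) g) x * dif w h x)"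
      by (rule integral_dif_mult) (intro bdd_measurable_dif bdd_measurable_walk g h)+
    then have "\<bar>?dd m\<bar> \<le> (LINT x|lborel. \<bar>dif w ((?T ^^ m) g) x * dif w h x\<bar>)" by simp
    also have "\<dots> \<le> (LINT x|lborel. (dif w ((?T ^^ m) g) x)\<^sup>2 / (2 * e) + e * (dif w h x)\<^sup>2 / 2)"
    proof (intro integral_mono integrable_abs ip Bochner_Integration.integrable_add integrable_divide integrable_mult_right ik iH)
      fix x
      let ?a = "dif w ((?T ^^ m) g) x" and ?b = "dif w h x"
      have "0 \<le> (\<bar>?a\<bar> - e * \<bar>?b\<bar>)\<^sup>2 / (2 * e)" using e by simp
      also have "\<dots> = ?a\<^sup>2 / (2 * e) + e * ?b\<^sup>2 / 2 - \<bar>?a * ?b\<bar>"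
        using e by (simp add: power2_diff abs_mult power_mult_distrib field_simps power2_eq_square)
      finally show "\<bar>?a * ?b\<bar> \<le> ?a\<^sup>2 / (2 * e) + e * ?b\<^sup>2 / 2" by simp
    qed
    also have "\<dots> = k m / (2 * e) + e * H / 2" using ik iH by (simp add: k_def H_def)
    finally show ?thesis .
  qed
  have "\<bar>?dd 0\<bar> \<le> N + e * H / 2" if e: "e > 0" for e
  proof -
    have "(\<lambda>M. k (2 * M)) \<longlonglongrightarrow> 0"
      using LIMSEQ_subseq_LIMSEQ[OF k0, of "\<lambda>M. 2 * M"] by (simp add: strict_mono_def o_def)
    then have lim: "(\<lambda>M. N + (k (2 * M) / (2 * e) + e * H / 2)) \<longlonglongrightarrow> N + (0 / (2 * e) + e * H / 2)"
      using e by (intro tendsto_intros) auto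
    have "\<bar>?dd 0\<bar> \<le> N + (k (2 * M) / (2 * e) + e * H / 2)" for M
      using bound[of M] rem[OF e, of "2 * M"] by linarith
    then have "\<bar>?dd 0\<bar> \<le> N + (0 / (2 * e) + e * H / 2)"
      by (intro LIMSEQ_le_const[OF lim]) auto
    then show ?thesis by simp
  qed
  then have le: "\<bar>?dd 0\<bar> \<le> N + e * H / 2" if "e > 0" for e using that .
  have "((\<lambda>e. N + e * H / 2) \<longlongrightarrow> N + 0 * H / 2) (at_right 0)" by (intro tendsto_intros) auto
  then have "\<bar>?dd 0\<bar> \<le> N + 0 * H / 2"
    by (rule tendsto_lowerbound) (rule eventually_mono[OF eventually_at_right_less], rule le, simp_all)
  then show ?thesis using real by (simp add: ennreal_leI)
next
  case top
  then show ?thesis by simp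
qed

text \<open>\<open>h\<close> is the extremal function of Hoelder duality for the second difference
  \<open>k\<close>, cut off to a ball. Because \<open>(p - 1) * q = p\<close>, both
  \<open>k * h\<close> and the \<open>q\<close>-th power of \<open>h\<close> are multiples of the
  same function, with factors \<open>t\<close> and \<open>t powr q\<close>. The condition on
  \<open>t\<close> makes the second term, times \<open>C\<close>, half of the first.\<close>

lemma second_difference_truncated_bound:
  fixes g :: "'a::euclidean_space \<Rightarrow> real" and R :: real
  assumes p: "1 < p" and q: "q = p / (p - 1)" and \<Phi>: "zigzag_convex \<Phi>"
    and le: "\<And>x y. \<Phi> x y \<le> C * (\<bar>x\<bar> powr p + \<bar>y\<bar> powr q)" and C: "C > 0"
    and t: "t > 0" "C * t powr q = t / 2"
    and w: "w \<in> set ws" and g: "bdd_measurable g" "integrable lborel (\<lambda>x. (g x)\<^sup>2)"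
  shows "(\<integral>\<^sup>+x. ennreal (\<bar>dif w (dif w g) x\<bar> powr p) * indicator (ball 0 R) x \<partial>lborel)
    \<le> ennreal (2 * C / t) * (\<integral>\<^sup>+x. ennreal (\<bar>avgs ws (avgs ws g) x - g x\<bar> powr p) \<partial>lborel)"
proof -
  define f where "f x = avgs ws (avgs ws g) x - g x" for x
  define k where "k = dif w (dif w g)"
  define h where "h x = t * (sgn (k x) * \<bar>k x\<bar> powr (p - 1) * indicat_real (ball 0 R) x)" for x
  define F where "F = (\<integral>\<^sup>+x. ennreal (\<bar>f x\<bar> powr p) \<partial>lborel)"
  have k: "bdd_measurable k" unfolding k_def by (intro bdd_measurable_dif g)
  then obtain B where [measurable]: "k \<in> borel_measurable borel" and B: "\<And>x. \<bar>k x\<bar> \<le> B"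
    by (auto simp: bdd_measurable_def)
  have [measurable]: "f \<in> borel_measurable borel"
    using bdd_measurable_diff[OF bdd_measurable_avgs[OF bdd_measurable_avgs[OF g(1)]] g(1)]
    by (simp add: bdd_measurable_def f_def[abs_def])
  have [measurable]: "ball (0::'a) R \<in> sets borel" by simp
  have [measurable]: "h \<in> borel_measurable borel" unfolding h_def[abs_def] by measurable
  have fin: "emeasure lborel (ball (0::'a) R) < \<infinity>"
    by (rule emeasure_lborel_ball_finite)
  have ball: "integrable lborel (indicat_real (ball (0::'a) R))"
    using fin by (intro integrable_real_indicator) auto
  have hle: "\<bar>h x\<bar> \<le> t * B powr (p - 1) * indicat_real (ball 0 R) x" for x
  proof -
    have "\<bar>k x\<bar> powr (p - 1) \<le> B powr (p - 1)" using p B by (intro powr_mono2) auto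
    then show ?thesis using t by (auto simp: h_def abs_mult abs_sgn_eq indicator_def)
  qed
  have h: "bdd_measurable h" "integrable lborel h"
  proof -
    have "\<bar>h x\<bar> \<le> t * B powr (p - 1)" for x
      by (rule order_trans[OF hle]) (use t in \<open>auto simp: indicator_def\<close>)
    then show "bdd_measurable h" by (auto simp: bdd_measurable_def)
    show "integrable lborel h"
      by (rule Bochner_Integration.integrable_bound[of _ "\<lambda>x. t * B powr (p - 1) * indicat_real (ball 0 R) x"])
         (use ball hle in \<open>auto intro!: AE_I2 intro: order_trans[OF _ abs_ge_self]\<close>)
  qed
  have kh: "k x * h x = t * (\<bar>k x\<bar> powr p * indicat_real (ball 0 R) x)" for x
  proof -
    have "k x * h x = t * ((k x * sgn (k x)) * \<bar>k x\<bar> powr (p - 1) * indicat_real (ball 0 R) x)"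
      by (simp only: h_def mult_ac)
    also have "k x * sgn (k x) = \<bar>k x\<bar>" by (simp add: sgn_if)
    also have "\<bar>k x\<bar> * \<bar>k x\<bar> powr (p - 1) = \<bar>k x\<bar> powr p"
      using powr_add[of "\<bar>k x\<bar>" 1 "p - 1"] by (cases "k x = 0") auto
    finally show ?thesis .
  qed
  have hq: "\<bar>h x\<bar> powr q = t powr q * (\<bar>k x\<bar> powr p * indicat_real (ball 0 R) x)" for x
  proof (cases "k x = 0 \<or> x \<notin> ball 0 R")
    case False
    then have "\<bar>h x\<bar> = t * \<bar>k x\<bar> powr (p - 1)" using t by (simp add: h_def abs_mult abs_sgn_eq)
    moreover have "(p - 1) * q = p" using p by (simp add: q)
    ultimately show ?thesis using False t by (simp add: powr_mult powr_powr)
  next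
    case True
    then show ?thesis by (auto simp: h_def)
  qed
  define a where "a = (LINT x|lborel. \<bar>k x\<bar> powr p * indicat_real (ball 0 R) x)"
  have ia: "integrable lborel (\<lambda>x. \<bar>k x\<bar> powr p * indicat_real (ball 0 R) x)"
    using integrable_bdd_mult[OF k h(2)] t unfolding kh by simp
  have a: "(\<integral>\<^sup>+x. ennreal (\<bar>k x\<bar> powr p * indicat_real (ball 0 R) x) \<partial>lborel) = ennreal a"
    unfolding a_def by (intro nn_integral_eq_integral ia) auto
  have a0: "a \<ge> 0" unfolding a_def by (intro integral_nonneg_AE) auto
  have "ennreal (t * a) = ennreal \<bar>LINT x|lborel. k x * h x\<bar>"
    using t a0 by (simp add: kh a_def)
  also have "\<dots> \<le> (\<integral>\<^sup>+x. ennreal (\<Phi> (f x) (h x)) \<partial>lborel)"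
    unfolding k_def f_def by (rule second_difference_pairing[OF \<Phi> w g h])
  also have "\<dots> \<le> (\<integral>\<^sup>+x. ennreal C * ennreal (\<bar>f x\<bar> powr p)
      + ennreal (t / 2) * ennreal (\<bar>k x\<bar> powr p * indicat_real (ball 0 R) x) \<partial>lborel)"
  proof (rule nn_integral_mono)
    fix x
    have "\<Phi> (f x) (h x) \<le> C * \<bar>f x\<bar> powr p + (C * t powr q) * (\<bar>k x\<bar> powr p * indicat_real (ball 0 R) x)"
      using le[of "f x" "h x"] by (simp add: hq algebra_simps)
    then show "ennreal (\<Phi> (f x) (h x)) \<le> ennreal C * ennreal (\<bar>f x\<bar> powr p)
      + ennreal (t / 2) * ennreal (\<bar>k x\<bar> powr p * indicat_real (ball 0 R) x)"
      unfolding t(2) using t C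
      by (subst ennreal_mult[symmetric], simp, simp, subst ennreal_mult[symmetric], simp, simp,
          subst ennreal_plus[symmetric], simp, simp, intro ennreal_leI)
  qed
  also have "\<dots> = ennreal C * F + ennreal (t / 2) * ennreal a"
    by (subst nn_integral_add) (auto simp: nn_integral_cmult a F_def)
  finally have main: "ennreal (t * a) \<le> ennreal C * F + ennreal (t / 2) * ennreal a" .
  have "ennreal a \<le> ennreal (2 * C / t) * F"
  proof (cases F rule: ennreal_cases)
    case (real r)
    \<comment> \<open>Absorption: \<open>a\<close> is a real number thanks to the cutoff, so
      \<open>t / 2 * a\<close> may be subtracted.\<close>
    have "t * a \<le> C * r + t / 2 * a"
      using main real C t a0
      by (simp add: ennreal_mult[symmetric] ennreal_plus[symmetric] ennreal_le_iff del: ennreal_plus)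
    then have "a \<le> 2 * C / t * r" using t by (simp add: field_simps)
    then show ?thesis using real C t a0 by (simp add: ennreal_mult[symmetric] ennreal_leI)
  next
    case top
    then show ?thesis using C t by (simp add: ennreal_mult_top)
  qed
  moreover have "(\<integral>\<^sup>+x. ennreal (\<bar>k x\<bar> powr p) * indicator (ball 0 R) x \<partial>lborel) = ennreal a"
    unfolding a[symmetric] by (intro nn_integral_cong) (simp add: indicator_def)
  ultimately show ?thesis by (simp add: F_def f_def k_def)
qed

text \<open>The cutoff is removed by monotone convergence over growing balls. The order of
  quantifiers matters: one constant serves all lists of directions, hence also all rescalings of a
  list.\<close>

lemma second_difference_Lp_bound:
  fixes p :: real
  assumes p: "1 < p"
  shows "\<exists>C>0. \<forall>ws (w :: 'a::euclidean_space) g.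
    w \<in> set ws \<longrightarrow> bdd_measurable g \<longrightarrow> integrable lborel (\<lambda>x. (g x)\<^sup>2) \<longrightarrow>
    (\<integral>\<^sup>+x. ennreal (\<bar>dif w (dif w g) x\<bar> powr p) \<partial>lborel)
      \<le> ennreal C * (\<integral>\<^sup>+x. ennreal (\<bar>avgs ws (avgs ws g) x - g x\<bar> powr p) \<partial>lborel)"
proof -
  define q where "q = p / (p - 1)"
  have q1: "q > 1" using p by (simp add: q_def field_simps)
  obtain \<Phi> C where zz: "zigzag_convex \<Phi>" and C: "C > 0"
    and le: "\<And>x y. \<Phi> x y \<le> C * (\<bar>x\<bar> powr p + \<bar>y\<bar> powr q)"
    by (rule zigzag_convex_exists[OF p q_def]) (rule that; assumption)
  \<comment> \<open>The positive solution of \<open>C * t powr q = t / 2\<close>; it exists since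
    \<open>q > 1\<close>.\<close>
  define t where "t = (1 / (2 * C)) powr (1 / (q - 1))"
  have t0: "t > 0" using C by (simp add: t_def)
  have "t powr q = t * t powr (q - 1)" using t0 powr_add[of t 1 "q - 1"] by simp
  also have "t powr (q - 1) = 1 / (2 * C)" using q1 C by (simp add: t_def powr_powr)
  finally have t: "C * t powr q = t / 2" using C by simp
  have "(\<integral>\<^sup>+x. ennreal (\<bar>dif w (dif w g) x\<bar> powr p) \<partial>lborel)
      \<le> ennreal (2 * C / t) * (\<integral>\<^sup>+x. ennreal (\<bar>avgs ws (avgs ws g) x - g x\<bar> powr p) \<partial>lborel)"
    if w: "w \<in> set ws" and g: "bdd_measurable g" "integrable lborel (\<lambda>x. (g x)\<^sup>2)"
    for ws and w :: 'a and g
  proof -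
    have [measurable]: "g \<in> borel_measurable borel" using g by (simp add: bdd_measurable_def)
    have [measurable]: "ball (0::'a) r \<in> sets borel" for r by simp
    let ?k = "\<lambda>x. ennreal (\<bar>dif w (dif w g) x\<bar> powr p)"
    have lim: "(\<lambda>n. \<integral>\<^sup>+x. ?k x * indicator (ball 0 (real n)) x \<partial>lborel) \<longlonglongrightarrow> (\<integral>\<^sup>+x. ?k x \<partial>lborel)"
    proof (rule nn_integral_LIMSEQ)
      show "incseq (\<lambda>n x. ?k x * indicator (ball 0 (real n)) x)"
        by (intro incseq_SucI le_funI mult_left_mono) (auto simp: indicator_def)
      show "(\<lambda>n. ?k x * indicator (ball 0 (real n)) x) \<longlonglongrightarrow> ?k x" for x
      proof (rule tendsto_eventually)
        obtain N where "norm x < real N" using reals_Archimedean2 by blast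
        then show "\<forall>\<^sub>F n in sequentially. ?k x * indicator (ball 0 (real n)) x = ?k x"
          by (intro eventually_sequentiallyI[of N]) (auto simp: indicator_def)
      qed
    qed measurable
    show ?thesis
      by (rule LIMSEQ_le_const2[OF lim])
         (use second_difference_truncated_bound[OF p q_def zz le C t0 t w g] in blast)
  qed
  moreover have "2 * C / t > 0" using C t0 by simp
  ultimately show ?thesis by blast
qed

section \<open>Second derivatives\<close>

lemma nn_integral_inverse_1_plus_square: "(\<integral>\<^sup>+t. ennreal (1 / (1 + t\<^sup>2)) \<partial>lborel) < \<infinity>"
proof -
  define h :: "real \<Rightarrow> ennreal" where "h t = ennreal (1 / (1 + t\<^sup>2)) * indicator {0..} t" for t
  have [measurable]: "h \<in> borel_measurable borel" unfolding h_def[abs_def] by measurable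
  have "(\<integral>\<^sup>+t. h t \<partial>lborel) = ennreal (pi / 2 - arctan 0)"
    unfolding h_def
  proof (rule nn_integral_FTC_atLeast)
    show "DERIV arctan x :> 1 / (1 + x\<^sup>2)" for x
      using DERIV_arctan[of x] by (simp add: field_simps)
    show "(arctan \<longlongrightarrow> pi / 2) at_top" by (rule tendsto_arctan_at_top)
  qed auto
  then have h: "(\<integral>\<^sup>+t. h t \<partial>lborel) < \<infinity>" by simp
  have "(\<integral>\<^sup>+t. h t \<partial>lborel) = (\<integral>\<^sup>+t. h (- t) \<partial>lborel)"
    by (subst nn_integral_real_affine[where c = "-1" and t = 0]) auto
  moreover have "(\<integral>\<^sup>+t. ennreal (1 / (1 + t\<^sup>2)) \<partial>lborel) \<le> (\<integral>\<^sup>+t. h t + h (- t) \<partial>lborel)"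
    by (intro nn_integral_mono) (auto simp: h_def indicator_def)
  moreover have "\<dots> = (\<integral>\<^sup>+t. h t \<partial>lborel) + (\<integral>\<^sup>+t. h (- t) \<partial>lborel)"
    by (intro nn_integral_add) auto
  ultimately show ?thesis using h by (simp add: order_le_less_trans)
qed

text \<open>The product form reduces integrability to one variable, and its reciprocal expands into
  even monomials, which the Schwartz seminorms control.\<close>

definition decay :: "real ^ 'n \<Rightarrow> real" where
  "decay y = (\<Prod>i\<in>UNIV. 1 / (1 + (y $ i)\<^sup>2))"

lemma decay_pos: "0 < decay y"
  by (auto simp: decay_def intro!: prod_pos add_pos_nonneg)

lemma decay_le_1: "decay y \<le> 1"
  unfolding decay_def by (intro prod_le_1) (auto simp: divide_le_eq_1_pos add_pos_nonneg)

lemma decay_measurable [measurable]: "decay \<in> borel_measurable borel"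
proof -
  have "continuous_on UNIV decay" unfolding decay_def
    by (intro continuous_intros) (auto simp: add_nonneg_eq_0_iff)
  then show ?thesis by (rule borel_measurable_continuous_onI)
qed

lemma nn_integral_decay: "(\<integral>\<^sup>+y. ennreal (decay (y :: real ^ 'n)) \<partial>lborel) < \<infinity>"
proof -
  have "ennreal (decay y) = (\<Prod>b\<in>Basis. ennreal (1 / (1 + (y \<bullet> b)\<^sup>2)))" for y :: "real ^ 'n"
  proof -
    have inj: "inj (\<lambda>i::'n. axis i (1::real))" by (auto simp: inj_on_def axis_eq_axis)
    have B: "(Basis :: (real ^ 'n) set) = range (\<lambda>i. axis i 1)" by (auto simp: Basis_vec_def)
    have "(\<Prod>b\<in>Basis. ennreal (1 / (1 + (y \<bullet> b)\<^sup>2))) = (\<Prod>i\<in>UNIV. ennreal (1 / (1 + (y $ i)\<^sup>2)))"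
      unfolding B by (subst prod.reindex[OF inj]) (simp add: inner_axis)
    also have "\<dots> = ennreal (decay y)" unfolding decay_def by (rule prod_ennreal) simp
    finally show ?thesis ..
  qed
  then have "(\<integral>\<^sup>+y. ennreal (decay (y :: real ^ 'n)) \<partial>lborel)
      = (\<integral>\<^sup>+y. (\<Prod>b\<in>Basis. ennreal (1 / (1 + ((y :: real ^ 'n) \<bullet> b)\<^sup>2))) \<partial>lborel)"
    by simp
  also have "\<dots> = (\<Prod>b\<in>(Basis :: (real ^ 'n) set). \<integral>\<^sup>+t. ennreal (1 / (1 + t\<^sup>2)) \<partial>lborel)"
    by (rule nn_integral_lborel_prod) auto
  also have "\<dots> < \<infinity>"
    using nn_integral_inverse_1_plus_square by (simp add: power_less_top_ennreal)
  finally show ?thesis .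
qed

text \<open>A Peetre-type inequality, coordinate by coordinate. It carries bounds from the
  intermediate points of mean value theorems back to the base point, with one constant for all
  shifts of parameter at most 1.\<close>

lemma decay_translate: "\<exists>K>0. \<forall>y \<xi>. \<bar>\<xi>\<bar> \<le> 1 \<longrightarrow> decay (y + \<xi> *\<^sub>R w) \<le> K * decay (y :: real ^ 'n)"
proof -
  define K where "K = (\<Prod>i\<in>(UNIV :: 'n set). 2 * (1 + (w $ i)\<^sup>2))"
  have "decay (y + \<xi> *\<^sub>R w) \<le> K * decay y" if "\<bar>\<xi>\<bar> \<le> 1" for y :: "real ^ 'n" and \<xi>
  proof -
    have "1 / (1 + (a + \<xi> * b)\<^sup>2) \<le> 2 * (1 + b\<^sup>2) * (1 / (1 + a\<^sup>2))" for a b :: real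
    proof -
      have "(\<xi> * b)\<^sup>2 \<le> 1 * b\<^sup>2" unfolding power_mult_distrib
        using that by (intro mult_right_mono) (auto simp: abs_square_le_1)
      \<comment> \<open>This square is exactly the difference of the two sides of the next
        inequality.\<close>
      moreover have "0 \<le> (a + 2 * (\<xi> * b))\<^sup>2" by simp
      then have "a\<^sup>2 \<le> 2 * (a + \<xi> * b)\<^sup>2 + 2 * (\<xi> * b)\<^sup>2" by (simp add: power2_eq_square algebra_simps)
      ultimately have "1 + a\<^sup>2 \<le> 2 * (1 + (a + \<xi> * b)\<^sup>2) + 2 * b\<^sup>2" by simp
      also have "\<dots> \<le> 2 * (1 + b\<^sup>2) * (1 + (a + \<xi> * b)\<^sup>2)"
        using zero_le_mult_iff[of "b\<^sup>2" "(a + \<xi> * b)\<^sup>2"] by (simp add: algebra_simps)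
      finally show ?thesis by (simp add: field_simps add_pos_nonneg)
    qed
    then have "decay (y + \<xi> *\<^sub>R w) \<le> (\<Prod>i\<in>UNIV. 2 * (1 + (w $ i)\<^sup>2) * (1 / (1 + (y $ i)\<^sup>2)))"
      unfolding decay_def by (intro prod_mono) (auto intro!: divide_nonneg_nonneg)
    also have "\<dots> = K * decay y" by (simp only: prod.distrib K_def decay_def)
    finally show ?thesis .
  qed
  moreover have "K > 0" unfolding K_def by (intro prod_pos) (auto intro!: add_pos_nonneg)
  ultimately show ?thesis by blast
qed

section \<open>Second difference quotients and their limits\<close>

lemma second_difference_MVT:
  fixes \<phi> :: "real \<Rightarrow> real"
  assumes d1: "\<And>t. (\<phi> has_real_derivative \<phi>1 t) (at t)"
    and d2: "\<And>t. (\<phi>1 has_real_derivative \<phi>2 t) (at t)"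
  shows "\<exists>s t. \<bar>s\<bar> \<le> 1 \<and> \<bar>t\<bar> \<le> 1 \<and> \<phi> 1 + \<phi> (-1) - 2 * \<phi> 0 = (\<phi>2 s + \<phi>2 t) / 2"
proof -
  define D where "D m = (if m = 0 then \<phi> else if m = 1 then \<phi>1 else \<phi>2)" for m :: nat
  have D: "\<forall>m t. m < 2 \<and> \<bar>t\<bar> \<le> \<bar>x\<bar> \<longrightarrow> DERIV (D m) t :> D (Suc m) t" for x :: real
    using d1 d2 by (auto simp: D_def less_2_cases_iff)
  \<comment> \<open>Taylor's formula with Lagrange remainder is used separately at 1 and -1. The
    first-order terms cancel in the sum, which leaves two intermediate points.\<close>
  have "\<exists>t. \<bar>t\<bar> \<le> \<bar>x\<bar> \<and> \<phi> x = (\<Sum>m<2. D m 0 / fact m * x ^ m) + D 2 t / fact 2 * x ^ 2" for x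
    by (rule Maclaurin_bi_le[OF _ D]) (simp add: D_def)
  then have T: "\<exists>t. \<bar>t\<bar> \<le> \<bar>x\<bar> \<and> \<phi> x = \<phi> 0 + \<phi>1 0 * x + \<phi>2 t / 2 * x ^ 2" for x
    by (simp add: D_def numeral_2_eq_2)
  obtain s where "\<bar>s\<bar> \<le> 1" "\<phi> 1 = \<phi> 0 + \<phi>1 0 + \<phi>2 s / 2" using T[of 1] by auto
  moreover obtain t where "\<bar>t\<bar> \<le> 1" "\<phi> (-1) = \<phi> 0 - \<phi>1 0 + \<phi>2 t / 2" using T[of "-1"] by auto
  ultimately show ?thesis by (intro exI[of _ s] exI[of _ t]) (simp add: field_simps)
qed

text \<open>Gradient and Hessian are explicit data, so that later estimates can name single entries;
  \<open>H i j\<close> differentiates \<open>G i\<close> in coordinate \<open>j\<close>. Symmetry of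
  \<open>H\<close> is derived from continuity in \<open>hess_symmetric\<close>.\<close>

definition C2_decay ::
  "(real ^ 'n \<Rightarrow> real) \<Rightarrow> ('n \<Rightarrow> real ^ 'n \<Rightarrow> real) \<Rightarrow> ('n \<Rightarrow> 'n \<Rightarrow> real ^ 'n \<Rightarrow> real) \<Rightarrow> bool" where
  "C2_decay g G H \<longleftrightarrow>
     (\<forall>x. (g has_derivative (\<lambda>v. \<Sum>i\<in>UNIV. v $ i * G i x)) (at x)) \<and>
     (\<forall>i x. (G i has_derivative (\<lambda>v. \<Sum>j\<in>UNIV. v $ j * H i j x)) (at x)) \<and>
     (\<forall>i j. continuous_on UNIV (H i j)) \<and>
     (\<exists>B. (\<forall>x. \<bar>g x\<bar> \<le> B * decay x) \<and> (\<forall>i j x. \<bar>H i j x\<bar> \<le> B * decay x))"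

definition hess_form :: "('n \<Rightarrow> 'n \<Rightarrow> real ^ 'n \<Rightarrow> real) \<Rightarrow> real ^ 'n \<Rightarrow> real ^ 'n \<Rightarrow> real" where
  "hess_form H w x = (\<Sum>i\<in>UNIV. \<Sum>j\<in>UNIV. w $ i * w $ j * H i j x)"

lemma hess_form_scaleR: "hess_form H (c *\<^sub>R w) x = c\<^sup>2 * hess_form H w x"
  by (simp add: hess_form_def sum_distrib_left power2_eq_square mult_ac)

lemma has_derivative_line:
  assumes "(f has_derivative f') (at (x + t *\<^sub>R w))"
  shows "((\<lambda>t. f (x + t *\<^sub>R w)) has_real_derivative f' w) (at t)"
proof -
  have "((\<lambda>t. x + t *\<^sub>R w) has_derivative (\<lambda>h. h *\<^sub>R w)) (at t)"
    by (auto intro!: derivative_eq_intros)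
  from has_derivative_compose[OF this assms]
  have "((\<lambda>t. f (x + t *\<^sub>R w)) has_derivative (\<lambda>h. f' (h *\<^sub>R w))) (at t)" .
  moreover have "f' (h *\<^sub>R w) = f' w * h" for h
    using linear_scale[OF has_derivative_linear[OF assms], of h w] by simp
  ultimately show ?thesis by (simp add: has_field_derivative_def mult_commute_abs)
qed

text \<open>\<open>avg w g - g\<close> is half of a second difference, which itself is a mean of two
  values of the Hessian form: hence the divisor 4, and a limit of half the Hessian form.\<close>

lemma second_difference_eq:
  fixes g :: "real ^ 'n \<Rightarrow> real"
  assumes C2: "C2_decay g G H" and e: "e \<noteq> 0"
  shows "\<exists>s t. \<bar>s\<bar> \<le> 1 \<and> \<bar>t\<bar> \<le> 1 \<and> (avg (e *\<^sub>R w) g x - g x) / e\<^sup>2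
    = (hess_form H w (x + s *\<^sub>R (e *\<^sub>R w)) + hess_form H w (x + t *\<^sub>R (e *\<^sub>R w))) / 4"
proof -
  let ?w = "e *\<^sub>R w"
  define \<phi> where "\<phi> t = g (x + t *\<^sub>R ?w)" for t
  define \<phi>1 where "\<phi>1 t = (\<Sum>i\<in>UNIV. ?w $ i * G i (x + t *\<^sub>R ?w))" for t
  define \<phi>2 where "\<phi>2 t = hess_form H ?w (x + t *\<^sub>R ?w)" for t
  have d1: "(\<phi> has_real_derivative \<phi>1 t) (at t)" for t
    unfolding \<phi>_def[abs_def] \<phi>1_def
    by (rule has_derivative_line) (use C2 in \<open>simp add: C2_decay_def\<close>)
  have dG: "((\<lambda>t. G i (x + t *\<^sub>R ?w)) has_real_derivative (\<Sum>j\<in>UNIV. ?w $ j * H i j (x + t *\<^sub>R ?w))) (at t)" for i t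
    by (rule has_derivative_line) (use C2 in \<open>simp add: C2_decay_def\<close>)
  have d2: "(\<phi>1 has_real_derivative \<phi>2 t) (at t)" for t
    unfolding \<phi>1_def[abs_def] \<phi>2_def hess_form_def
    by (rule DERIV_cong[OF DERIV_sum[OF DERIV_cmult[OF dG]]]) (simp add: sum_distrib_left mult_ac)
  obtain s t where st: "\<bar>s\<bar> \<le> 1" "\<bar>t\<bar> \<le> 1" "\<phi> 1 + \<phi> (-1) - 2 * \<phi> 0 = (\<phi>2 s + \<phi>2 t) / 2"
    using second_difference_MVT[OF d1 d2] by blast
  have "(avg ?w g x - g x) / e\<^sup>2 = (\<phi> 1 + \<phi> (-1) - 2 * \<phi> 0) / (2 * e\<^sup>2)"
    by (simp add: avg_def \<phi>_def field_simps)
  also have "\<dots> = (hess_form H w (x + s *\<^sub>R ?w) + hess_form H w (x + t *\<^sub>R ?w)) / 4"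
    unfolding st(3) \<phi>2_def hess_form_scaleR using e by (simp add: field_simps)
  finally show ?thesis using st by blast
qed

lemma hess_form_continuous: "C2_decay g G H \<Longrightarrow> continuous_on UNIV (hess_form H w)"
  unfolding hess_form_def[abs_def] C2_decay_def by (intro continuous_intros) auto

lemma hess_form_decay:
  assumes "C2_decay g G H"
  shows "\<exists>B\<ge>0. \<forall>x. \<bar>hess_form H w x\<bar> \<le> B * decay x"
proof -
  obtain B where B: "\<And>i j x. \<bar>H i j x\<bar> \<le> B * decay x" using assms by (auto simp: C2_decay_def)
  have B0: "B \<ge> 0" using B[of undefined undefined 0] decay_pos[of 0]
    by (meson abs_ge_zero order_trans zero_le_mult_iff not_le)
  define A where "A = (\<Sum>i\<in>UNIV. \<Sum>j\<in>UNIV. \<bar>w $ i * w $ j\<bar>)"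
  have "\<bar>hess_form H w x\<bar> \<le> A * B * decay x" for x
  proof -
    have "\<bar>hess_form H w x\<bar> \<le> (\<Sum>i\<in>UNIV. \<Sum>j\<in>UNIV. \<bar>w $ i * w $ j * H i j x\<bar>)"
      unfolding hess_form_def by (intro order_trans[OF sum_abs] sum_mono sum_abs)
    also have "\<dots> \<le> (\<Sum>i\<in>UNIV. \<Sum>j\<in>UNIV. \<bar>w $ i * w $ j\<bar> * (B * decay x))"
      unfolding abs_mult[of "_ * _"] by (intro sum_mono mult_left_mono B) auto
    also have "\<dots> = A * B * decay x" by (simp add: A_def sum_distrib_right mult.assoc)
    finally show ?thesis .
  qed
  moreover have "A \<ge> 0" unfolding A_def by (intro sum_nonneg) auto
  ultimately show ?thesis using B0 by (intro exI[of _ "A * B"]) auto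
qed

lemma avgs_append: "avgs (ws @ ws') f = avgs ws (avgs ws' f)"
  by (induction ws) simp_all

text \<open>The generator of the walk: second-order terms of the single averages add up. The base
  point \<open>y n\<close> varies because the induction evaluates the quotient for the shorter list
  at points shifted by the current step.\<close>

lemma avgs_quotient_tendsto:
  fixes g :: "real ^ 'n \<Rightarrow> real"
  assumes C2: "C2_decay g G H" and e: "\<And>n. e n \<noteq> (0::real)" "e \<longlonglongrightarrow> 0"
  shows "y \<longlonglongrightarrow> x \<Longrightarrow> (\<lambda>n. (avgs (map ((*\<^sub>R) (e n)) ws) g (y n) - g (y n)) / (e n)\<^sup>2)
    \<longlonglongrightarrow> (\<Sum>w\<leftarrow>ws. hess_form H w x) / 2"
proof (induction ws arbitrary: y)
  case (Cons w ws)
  define S where "S n z = (avgs (map ((*\<^sub>R) (e n)) ws) g z - g z) / (e n)\<^sup>2" for n z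
  have ew: "(\<lambda>n. e n *\<^sub>R w) \<longlonglongrightarrow> 0" using tendsto_scaleR[OF e(2) tendsto_const[of w]] by simp
  have "(\<lambda>n. (avg (e n *\<^sub>R w) g (y n) - g (y n)) / (e n)\<^sup>2) \<longlonglongrightarrow> hess_form H w x / 2"
  proof -
    have "\<forall>n. \<exists>s t. \<bar>s\<bar> \<le> 1 \<and> \<bar>t\<bar> \<le> 1 \<and> (avg (e n *\<^sub>R w) g (y n) - g (y n)) / (e n)\<^sup>2
      = (hess_form H w (y n + s *\<^sub>R (e n *\<^sub>R w)) + hess_form H w (y n + t *\<^sub>R (e n *\<^sub>R w))) / 4"
      using second_difference_eq[OF C2 e(1)] by blast
    then obtain s t where st: "\<And>n. \<bar>s n\<bar> \<le> 1" "\<And>n. \<bar>t n\<bar> \<le> 1"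
      and eq: "\<And>n. (avg (e n *\<^sub>R w) g (y n) - g (y n)) / (e n)\<^sup>2
        = (hess_form H w (y n + s n *\<^sub>R (e n *\<^sub>R w)) + hess_form H w (y n + t n *\<^sub>R (e n *\<^sub>R w))) / 4"
      by metis
    have lim: "(\<lambda>n. hess_form H w (y n + r n *\<^sub>R (e n *\<^sub>R w))) \<longlonglongrightarrow> hess_form H w x"
      if r: "\<And>n. \<bar>r n\<bar> \<le> 1" for r :: "nat \<Rightarrow> real"
    proof -
      have "(\<lambda>n. r n *\<^sub>R (e n *\<^sub>R w)) \<longlonglongrightarrow> 0"
      proof (rule Lim_null_comparison[OF _ tendsto_norm_zero[OF ew]], intro always_eventually allI)
        show "norm (r n *\<^sub>R (e n *\<^sub>R w)) \<le> norm (e n *\<^sub>R w)" for n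
          unfolding norm_scaleR[of "r n"] using r[of n] by (intro mult_left_le_one_le) auto
      qed
      from tendsto_add[OF Cons.prems this]
      have "(\<lambda>n. y n + r n *\<^sub>R (e n *\<^sub>R w)) \<longlonglongrightarrow> x" by simp
      moreover have "isCont (hess_form H w) x"
        using hess_form_continuous[OF C2] by (simp add: continuous_on_eq_continuous_at)
      ultimately show ?thesis by (rule isCont_tendsto_compose[rotated])
    qed
    show ?thesis unfolding eq
      by (rule tendsto_eq_intros lim st refl)+ simp_all
  qed
  moreover have "(\<lambda>n. (S n (y n + e n *\<^sub>R w) + S n (y n - e n *\<^sub>R w)) / 2)
      \<longlonglongrightarrow> ((\<Sum>w\<leftarrow>ws. hess_form H w x) / 2 + (\<Sum>w\<leftarrow>ws. hess_form H w x) / 2) / 2"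
    unfolding S_def using tendsto_add[OF Cons.prems ew] tendsto_diff[OF Cons.prems ew]
    by (intro tendsto_intros Cons.IH) auto
  ultimately have "(\<lambda>n. (S n (y n + e n *\<^sub>R w) + S n (y n - e n *\<^sub>R w)) / 2
      + (avg (e n *\<^sub>R w) g (y n) - g (y n)) / (e n)\<^sup>2)
     \<longlonglongrightarrow> ((\<Sum>w\<leftarrow>ws. hess_form H w x) / 2 + (\<Sum>w\<leftarrow>ws. hess_form H w x) / 2) / 2 + hess_form H w x / 2"
    by (intro tendsto_add)
  \<comment> \<open>With \<open>A\<close> the averages over \<open>ws\<close>, this splits
    \<open>avg w (A g) - g\<close> into \<open>avg w (A g - g)\<close> and
    \<open>avg w g - g\<close>.\<close>
  moreover have "(S n (y n + e n *\<^sub>R w) + S n (y n - e n *\<^sub>R w)) / 2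
      + (avg (e n *\<^sub>R w) g (y n) - g (y n)) / (e n)\<^sup>2
      = (avgs (map ((*\<^sub>R) (e n)) (w # ws)) g (y n) - g (y n)) / (e n)\<^sup>2" for n
    by (simp add: S_def avg_def add_divide_distrib diff_divide_distrib)
  ultimately show ?case by (simp add: add_divide_distrib add.commute)
qed simp

text \<open>The same splitting, now with bounds uniform in the step length; this is the majorant for
  dominated convergence.\<close>

lemma avgs_quotient_bound:
  fixes g :: "real ^ 'n \<Rightarrow> real"
  assumes C2: "C2_decay g G H"
  shows "\<exists>B\<ge>0. \<forall>e y. e \<noteq> 0 \<longrightarrow> \<bar>e\<bar> \<le> 1 \<longrightarrow>
    \<bar>(avgs (map ((*\<^sub>R) e) ws) g y - g y) / e\<^sup>2\<bar> \<le> B * decay y"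
proof (induction ws)
  case (Cons w ws)
  then obtain B where B: "B \<ge> 0" "\<And>e y. e \<noteq> 0 \<Longrightarrow> \<bar>e\<bar> \<le> 1 \<Longrightarrow>
    \<bar>(avgs (map ((*\<^sub>R) e) ws) g y - g y) / e\<^sup>2\<bar> \<le> B * decay y" by blast
  obtain A where A: "A \<ge> 0" "\<And>x. \<bar>hess_form H w x\<bar> \<le> A * decay x" using hess_form_decay[OF C2] by blast
  obtain K where K: "K > 0" "\<And>y \<xi>. \<bar>\<xi>\<bar> \<le> 1 \<Longrightarrow> decay (y + \<xi> *\<^sub>R w) \<le> K * decay y"
    using decay_translate[of w] by blast
  have "\<bar>(avgs (map ((*\<^sub>R) e) (w # ws)) g y - g y) / e\<^sup>2\<bar> \<le> (B * K + A * K) * decay y"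
    if e: "e \<noteq> 0" "\<bar>e\<bar> \<le> 1" for e y
  proof -
    define S where "S z = (avgs (map ((*\<^sub>R) e) ws) g z - g z) / e\<^sup>2" for z
    have S: "\<bar>S (y + \<xi> *\<^sub>R w)\<bar> \<le> B * (K * decay y)" if "\<bar>\<xi>\<bar> \<le> 1" for \<xi>
      unfolding S_def using B(1) by (intro order_trans[OF B(2)[OF e]] mult_left_mono K that)
    have Q: "\<bar>hess_form H w (y + s *\<^sub>R (e *\<^sub>R w))\<bar> \<le> A * (K * decay y)" if "\<bar>s\<bar> \<le> 1" for s
    proof -
      have "\<bar>s * e\<bar> \<le> 1" using that e by (simp add: abs_mult mult_le_one)
      then have "decay (y + (s * e) *\<^sub>R w) \<le> K * decay y" by (rule K(2))
      then show ?thesis using order_trans[OF A(2) mult_left_mono[OF _ A(1)]] by simp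
    qed
    obtain s t where st: "\<bar>s\<bar> \<le> 1" "\<bar>t\<bar> \<le> 1" "(avg (e *\<^sub>R w) g y - g y) / e\<^sup>2
        = (hess_form H w (y + s *\<^sub>R (e *\<^sub>R w)) + hess_form H w (y + t *\<^sub>R (e *\<^sub>R w))) / 4"
      using second_difference_eq[OF C2 e(1)] by blast
    have "(avgs (map ((*\<^sub>R) e) (w # ws)) g y - g y) / e\<^sup>2 =
        (S (y + e *\<^sub>R w) + S (y + (- e) *\<^sub>R w)) / 2 + (avg (e *\<^sub>R w) g y - g y) / e\<^sup>2"
      by (simp add: S_def avg_def add_divide_distrib diff_divide_distrib)
    moreover have "\<bar>(a + b) / 2 + (c + d) / 4\<bar> \<le> P + M"
      if "\<bar>a\<bar> \<le> P" "\<bar>b\<bar> \<le> P" "\<bar>c\<bar> \<le> M" "\<bar>d\<bar> \<le> M" for a b c d P M :: real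
      using that by argo
    ultimately show ?thesis
      unfolding st(3) distrib_right mult.assoc using S[of e] S[of "- e"] Q[OF st(1)] Q[OF st(2)] e by simp
  qed
  moreover have "B * K + A * K \<ge> 0" using A B K by simp
  ultimately show ?case by blast
qed (auto intro: exI[of _ 0])

lemma C2_decay_borel: "C2_decay g G H \<Longrightarrow> g \<in> borel_measurable borel"
  unfolding C2_decay_def
  by (intro borel_measurable_continuous_onI continuous_at_imp_continuous_on)
     (auto intro: has_derivative_continuous)

lemma C2_decay_bdd_measurable: "C2_decay g G H \<Longrightarrow> bdd_measurable g"
proof -
  assume C2: "C2_decay g G H"
  then obtain B where B: "\<And>x. \<bar>g x\<bar> \<le> B * decay x" by (auto simp: C2_decay_def)
  have "0 \<le> B" using order_trans[OF abs_ge_zero B[of 0]] by (metis decay_pos mult_neg_pos not_le)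
  then have "\<bar>g x\<bar> \<le> B" for x
    using order_trans[OF B mult_left_mono[OF decay_le_1, of B x]] by simp
  then show ?thesis using C2_decay_borel[OF C2] by (auto simp: bdd_measurable_def)
qed

lemma C2_decay_square_integrable: "C2_decay g G H \<Longrightarrow> integrable lborel (\<lambda>x. (g x)\<^sup>2)"
proof -
  assume C2: "C2_decay g G H"
  then obtain B where B: "\<And>x. \<bar>g x\<bar> \<le> B * decay x" by (auto simp: C2_decay_def)
  note [measurable] = C2_decay_borel[OF C2]
  have le: "(g x)\<^sup>2 \<le> B\<^sup>2 * decay x" for x
  proof -
    have "(g x)\<^sup>2 \<le> (B * decay x)\<^sup>2" using power_mono[OF B[of x], of 2] by simp
    also have "\<dots> = B\<^sup>2 * (decay x * decay x)" by (simp add: power2_eq_square)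
    also have "\<dots> \<le> B\<^sup>2 * (decay x * 1)"
      using decay_pos[of x] by (intro mult_left_mono decay_le_1) auto
    finally show ?thesis by simp
  qed
  have "integrable lborel (\<lambda>x :: real ^ 'a. decay x)"
    by (rule integrableI_nonneg) (use nn_integral_decay decay_pos in \<open>auto intro: less_imp_le\<close>)
  then have "integrable lborel (\<lambda>x :: real ^ 'a. B\<^sup>2 * decay x)" by simp
  then show ?thesis
  proof (rule Bochner_Integration.integrable_bound)
    show "AE x in lborel. norm ((g x)\<^sup>2) \<le> norm (B\<^sup>2 * decay x)"
    proof (rule AE_I2)
      fix x
      show "norm ((g x)\<^sup>2) \<le> norm (B\<^sup>2 * decay x)" using le[of x] decay_pos[of x] by (simp add: abs_mult)
    qed
  qed measurable
qed

text \<open>The discrete bound is applied to steps scaled by \<open>e n\<close>, and both sides are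
  divided by the same power of \<open>e n\<close>. In the limit the left side is handled by Fatou's
  lemma and the right side by dominated convergence.\<close>

lemma hess_form_Lp_bound:
  fixes p :: real
  assumes p: "1 < p"
  shows "\<exists>C>0. \<forall>ws (w :: real ^ 'n) g G H. w \<in> set ws \<longrightarrow> C2_decay g G H \<longrightarrow>
    (\<integral>\<^sup>+x. ennreal (\<bar>hess_form H w x\<bar> powr p) \<partial>lborel)
      \<le> ennreal C * (\<integral>\<^sup>+x. ennreal (\<bar>\<Sum>v\<leftarrow>ws. hess_form H v x\<bar> powr p) \<partial>lborel)"
proof -
  obtain C where C: "C > 0" and bound: "\<And>ws (w :: real ^ 'n) g.
    w \<in> set ws \<Longrightarrow> bdd_measurable g \<Longrightarrow> integrable lborel (\<lambda>x. (g x)\<^sup>2) \<Longrightarrow>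
    (\<integral>\<^sup>+x. ennreal (\<bar>dif w (dif w g) x\<bar> powr p) \<partial>lborel)
      \<le> ennreal C * (\<integral>\<^sup>+x. ennreal (\<bar>avgs ws (avgs ws g) x - g x\<bar> powr p) \<partial>lborel)"
    using second_difference_Lp_bound[OF p, where 'a = "real ^ 'n"] by auto
  have "(\<integral>\<^sup>+x. ennreal (\<bar>hess_form H w x\<bar> powr p) \<partial>lborel)
      \<le> ennreal C * (\<integral>\<^sup>+x. ennreal (\<bar>\<Sum>v\<leftarrow>ws. hess_form H v x\<bar> powr p) \<partial>lborel)"
    if w: "w \<in> set ws" and C2: "C2_decay g G H" for ws and w :: "real ^ 'n" and g G H
  proof -
    define e where "e n = 1 / real (Suc n)" for n
    have e0: "e n \<noteq> 0" "\<bar>e n\<bar> \<le> 1" "0 < e n" for n by (auto simp: e_def)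
    have elim: "e \<longlonglongrightarrow> 0" unfolding e_def[abs_def] by (rule LIMSEQ_Suc[OF lim_1_over_n])
    note [measurable] = C2_decay_borel[OF C2]
    define k where "k n x = dif (e n *\<^sub>R w) (dif (e n *\<^sub>R w) g) x / (e n)\<^sup>2" for n x
    define T where "T n = avgs (map ((*\<^sub>R) (e n)) ws)" for n
    define f where "f n x = (T n (T n g) x - g x) / (e n)\<^sup>2" for n x
    have [measurable]: "k n \<in> borel_measurable borel" "f n \<in> borel_measurable borel" for n
      unfolding k_def[abs_def] f_def[abs_def] T_def by measurable
    have Tapp: "T n (T n g) = avgs (map ((*\<^sub>R) (e n)) (ws @ ws)) g" for n
      by (simp add: T_def avgs_append)
    have klim: "(\<lambda>n. k n x) \<longlonglongrightarrow> hess_form H w x" for x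
    proof -
      \<comment> \<open>Two differences in direction \<open>w\<close> make half of
        \<open>avg\<close> minus identity with the doubled step \<open>2 *\<^sub>R w\<close>; the
        factor 4 from scaling the Hessian form cancels both halves.\<close>
      have "(\<lambda>n. (avgs (map ((*\<^sub>R) (e n)) [2 *\<^sub>R w]) g x - g x) / (e n)\<^sup>2 / 2)
        \<longlonglongrightarrow> (\<Sum>v\<leftarrow>[2 *\<^sub>R w]. hess_form H v x) / 2 / 2"
        by (intro tendsto_divide avgs_quotient_tendsto[OF C2 e0(1) elim] tendsto_const) auto
      moreover have "(avgs (map ((*\<^sub>R) (e n)) [2 *\<^sub>R w]) g x - g x) / (e n)\<^sup>2 / 2 = k n x" for n
      proof -
        have "x + e n *\<^sub>R w + e n *\<^sub>R w = x + e n *\<^sub>R 2 *\<^sub>R w"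
          "x - e n *\<^sub>R w - e n *\<^sub>R w = x - e n *\<^sub>R 2 *\<^sub>R w"
          by (simp_all add: scaleR_2 scaleR_add_right algebra_simps)
        then show ?thesis using e0(1)[of n] by (simp add: k_def dif_def avg_def field_simps)
      qed
      moreover have "(\<Sum>v\<leftarrow>[2 *\<^sub>R w]. hess_form H v x) / 2 / 2 = hess_form H w x"
        by (simp add: hess_form_scaleR)
      ultimately show ?thesis by simp
    qed
    \<comment> \<open>Applying \<open>T n\<close> twice runs through the list twice, which
      compensates the factor 1/2 in the generator.\<close>
    have flim: "(\<lambda>n. f n x) \<longlonglongrightarrow> (\<Sum>v\<leftarrow>ws. hess_form H v x)" for x
      using avgs_quotient_tendsto[OF C2 e0(1) elim tendsto_const, of "ws @ ws" x]
      by (simp add: f_def Tapp)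
    obtain B where B: "B \<ge> 0" "\<And>n x. \<bar>f n x\<bar> \<le> B * decay x"
      using avgs_quotient_bound[OF C2, of "ws @ ws"] e0 unfolding f_def Tapp by blast
    have le: "(\<integral>\<^sup>+x. ennreal (\<bar>k n x\<bar> powr p) \<partial>lborel) \<le> ennreal C * (\<integral>\<^sup>+x. ennreal (\<bar>f n x\<bar> powr p) \<partial>lborel)" for n
    proof -
      let ?c = "ennreal ((1 / (e n)\<^sup>2) powr p)"
      have sc: "ennreal (\<bar>a / (e n)\<^sup>2\<bar> powr p) = ?c * ennreal (\<bar>a\<bar> powr p)" for a
        by (subst ennreal_mult[symmetric]) (auto simp: powr_mult[symmetric] abs_mult)
      have "e n *\<^sub>R w \<in> set (map ((*\<^sub>R) (e n)) ws)" using w by auto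
      from bound[OF this C2_decay_bdd_measurable[OF C2] C2_decay_square_integrable[OF C2]]
      have "?c * (\<integral>\<^sup>+x. ennreal (\<bar>dif (e n *\<^sub>R w) (dif (e n *\<^sub>R w) g) x\<bar> powr p) \<partial>lborel)
        \<le> ?c * (ennreal C * (\<integral>\<^sup>+x. ennreal (\<bar>T n (T n g) x - g x\<bar> powr p) \<partial>lborel))"
        unfolding T_def by (intro mult_left_mono) auto
      moreover have "(\<integral>\<^sup>+x. ennreal (\<bar>k n x\<bar> powr p) \<partial>lborel)
        = ?c * (\<integral>\<^sup>+x. ennreal (\<bar>dif (e n *\<^sub>R w) (dif (e n *\<^sub>R w) g) x\<bar> powr p) \<partial>lborel)"
        unfolding k_def sc by (rule nn_integral_cmult) measurable
      moreover have "(\<integral>\<^sup>+x. ennreal (\<bar>f n x\<bar> powr p) \<partial>lborel)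
        = ?c * (\<integral>\<^sup>+x. ennreal (\<bar>T n (T n g) x - g x\<bar> powr p) \<partial>lborel)"
        unfolding f_def sc by (rule nn_integral_cmult) (simp add: T_def)
      ultimately show ?thesis by (simp add: mult_ac)
    qed
    have RHS: "(\<lambda>n. \<integral>\<^sup>+x. ennreal (\<bar>f n x\<bar> powr p) \<partial>lborel)
      \<longlonglongrightarrow> (\<integral>\<^sup>+x. ennreal (\<bar>\<Sum>v\<leftarrow>ws. hess_form H v x\<bar> powr p) \<partial>lborel)"
    proof (rule nn_integral_dominated_convergence)
      have "(\<lambda>x. \<Sum>v\<leftarrow>ws. hess_form H v x) \<in> borel_measurable borel"
        by (rule borel_measurable_LIMSEQ_real[OF flim]) measurable
      then show "(\<lambda>x. ennreal (\<bar>\<Sum>v\<leftarrow>ws. hess_form H v x\<bar> powr p)) \<in> borel_measurable lborel"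
        by measurable
      show "AE x in lborel. ennreal (\<bar>f n x\<bar> powr p) \<le> ennreal (B powr p) * ennreal (decay x)" for n
      proof (rule AE_I2)
        fix x
        have "\<bar>f n x\<bar> powr p \<le> (B * decay x) powr p" using B p by (intro powr_mono2) auto
        also have "\<dots> = B powr p * decay x powr p" using B decay_pos[of x] by (simp add: powr_mult)
        also have "\<dots> \<le> B powr p * decay x"
          using powr_mono'[of 1 p "decay x"] p decay_pos[of x] decay_le_1[of x]
          by (intro mult_left_mono) auto
        finally show "ennreal (\<bar>f n x\<bar> powr p) \<le> ennreal (B powr p) * ennreal (decay x)"
          using decay_pos[of x] by (subst ennreal_mult[symmetric]) (auto intro: ennreal_leI)
      qed
      have "(\<integral>\<^sup>+x. ennreal (B powr p) * ennreal (decay (x :: real ^ 'n)) \<partial>lborel)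
          = ennreal (B powr p) * (\<integral>\<^sup>+x. ennreal (decay (x :: real ^ 'n)) \<partial>lborel)"
        by (rule nn_integral_cmult) measurable
      also have "\<dots> < \<infinity>" using nn_integral_decay[where 'n = 'n] by (simp add: ennreal_mult_less_top)
      finally show "(\<integral>\<^sup>+x. ennreal (B powr p) * ennreal (decay (x :: real ^ 'n)) \<partial>lborel) < \<infinity>" .
      show "AE x in lborel. (\<lambda>n. ennreal (\<bar>f n x\<bar> powr p)) \<longlonglongrightarrow> ennreal (\<bar>\<Sum>v\<leftarrow>ws. hess_form H v x\<bar> powr p)"
        using p by (intro AE_I2 tendsto_ennrealI tendsto_powr2 tendsto_rabs flim tendsto_const) auto
    qed measurable
    have "(\<lambda>n. ennreal (\<bar>k n x\<bar> powr p)) \<longlonglongrightarrow> ennreal (\<bar>hess_form H w x\<bar> powr p)" for x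
      using p by (intro tendsto_ennrealI tendsto_powr2 tendsto_rabs klim tendsto_const) auto
    then have "liminf (\<lambda>n. ennreal (\<bar>k n x\<bar> powr p)) = ennreal (\<bar>hess_form H w x\<bar> powr p)" for x
      by (intro lim_imp_Liminf) auto
    then have "(\<integral>\<^sup>+x. ennreal (\<bar>hess_form H w x\<bar> powr p) \<partial>lborel)
        = (\<integral>\<^sup>+x. liminf (\<lambda>n. ennreal (\<bar>k n x\<bar> powr p)) \<partial>lborel)" by simp
    also have "\<dots> \<le> liminf (\<lambda>n. \<integral>\<^sup>+x. ennreal (\<bar>k n x\<bar> powr p) \<partial>lborel)"
      by (rule nn_integral_liminf) measurable
    also have "\<dots> \<le> liminf (\<lambda>n. ennreal C * (\<integral>\<^sup>+x. ennreal (\<bar>f n x\<bar> powr p) \<partial>lborel))"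
      by (intro Liminf_mono always_eventually allI le)
    also have "\<dots> = ennreal C * (\<integral>\<^sup>+x. ennreal (\<bar>\<Sum>v\<leftarrow>ws. hess_form H v x\<bar> powr p) \<partial>lborel)"
      by (intro lim_imp_Liminf ennreal_tendsto_cmult RHS) auto
    finally show ?thesis .
  qed
  with C show ?thesis by blast
qed

text \<open>Clairaut's theorem: the mixed second difference over a square of side \<open>e\<close>
  is \<open>e^2\<close> times a value of \<open>H i j\<close> and also of \<open>H j i\<close> at
  nearby points, by two mean value theorems in either order. Shrinking the square and continuity
  give equality at \<open>x\<close>.\<close>

lemma hess_symmetric:
  assumes C2: "C2_decay g G H"
  shows "H i j x = H j i x"
proof -
  have d1: "((\<lambda>t. g (z + t *\<^sub>R axis i 1)) has_real_derivative G i (z + t *\<^sub>R axis i 1)) (at t)" for z t i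
    by (rule DERIV_cong[OF has_derivative_line[where f = g and x = z and w = "axis i 1"
          and f' = "\<lambda>v. \<Sum>k\<in>UNIV. v $ k * G k (z + t *\<^sub>R axis i 1)"]])
       (use C2 in \<open>auto simp: C2_decay_def axis_def if_distrib[of "\<lambda>c. c * _"] cong: if_cong\<close>)
  have d2: "((\<lambda>t. G i (z + t *\<^sub>R axis j 1)) has_real_derivative H i j (z + t *\<^sub>R axis j 1)) (at t)" for z t i j
    by (rule DERIV_cong[OF has_derivative_line[where f = "G i" and x = z and w = "axis j 1"
          and f' = "\<lambda>v. \<Sum>k\<in>UNIV. v $ k * H i k (z + t *\<^sub>R axis j 1)"]])
       (use C2 in \<open>auto simp: C2_decay_def axis_def if_distrib[of "\<lambda>c. c * _"] cong: if_cong\<close>)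
  have mixed: "\<exists>s t. 0 < s \<and> s < e \<and> 0 < t \<and> t < e \<and>
      g (x + e *\<^sub>R axis i 1 + e *\<^sub>R axis j 1) - g (x + e *\<^sub>R axis i 1) - g (x + e *\<^sub>R axis j 1) + g x
      = e * (e * H i j (x + s *\<^sub>R axis i 1 + t *\<^sub>R axis j 1))" if e: "0 < e" for e i j
  proof -
    define a where "a s = g (x + e *\<^sub>R axis j 1 + s *\<^sub>R axis i 1) - g (x + s *\<^sub>R axis i 1)" for s
    have "(a has_real_derivative G i (x + e *\<^sub>R axis j 1 + s *\<^sub>R axis i 1) - G i (x + s *\<^sub>R axis i 1)) (at s)" for s
      unfolding a_def[abs_def] by (intro DERIV_diff d1)
    from MVT2[OF e this] obtain s where s: "0 < s" "s < e"
      "a e - a 0 = (e - 0) * (G i (x + e *\<^sub>R axis j 1 + s *\<^sub>R axis i 1) - G i (x + s *\<^sub>R axis i 1))" by blast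
    from MVT2[OF e d2[of i "x + s *\<^sub>R axis i 1" j]] obtain t where t: "0 < t" "t < e"
      "G i (x + s *\<^sub>R axis i 1 + e *\<^sub>R axis j 1) - G i (x + s *\<^sub>R axis i 1 + 0 *\<^sub>R axis j 1)
        = (e - 0) * H i j (x + s *\<^sub>R axis i 1 + t *\<^sub>R axis j 1)" by blast
    have "a e - a 0 = g (x + e *\<^sub>R axis i 1 + e *\<^sub>R axis j 1) - g (x + e *\<^sub>R axis i 1) - g (x + e *\<^sub>R axis j 1) + g x"
      by (simp add: a_def add_ac)
    moreover have "x + e *\<^sub>R axis j 1 + s *\<^sub>R axis i 1 = x + s *\<^sub>R axis i 1 + e *\<^sub>R axis j 1" by (simp add: add_ac)
    ultimately show ?thesis using s t by (intro exI[of _ s] exI[of _ t]) simp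
  qed
  define e where "e n = 1 / real (Suc n)" for n
  have e0: "0 < e n" for n by (simp add: e_def)
  have elim: "e \<longlonglongrightarrow> 0" unfolding e_def[abs_def] by (rule LIMSEQ_Suc[OF lim_1_over_n])
  have "\<exists>s t s' t'. 0 < s \<and> s < e n \<and> 0 < t \<and> t < e n \<and> 0 < s' \<and> s' < e n \<and> 0 < t' \<and> t' < e n \<and>
      H i j (x + s *\<^sub>R axis i 1 + t *\<^sub>R axis j 1) = H j i (x + s' *\<^sub>R axis j 1 + t' *\<^sub>R axis i 1)" for n
  proof -
    obtain s t where 1: "0 < s" "s < e n" "0 < t" "t < e n"
      "g (x + e n *\<^sub>R axis i 1 + e n *\<^sub>R axis j 1) - g (x + e n *\<^sub>R axis i 1) - g (x + e n *\<^sub>R axis j 1) + g x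
      = e n * (e n * H i j (x + s *\<^sub>R axis i 1 + t *\<^sub>R axis j 1))" using mixed[OF e0] by blast
    obtain s' t' where 2: "0 < s'" "s' < e n" "0 < t'" "t' < e n"
      "g (x + e n *\<^sub>R axis j 1 + e n *\<^sub>R axis i 1) - g (x + e n *\<^sub>R axis j 1) - g (x + e n *\<^sub>R axis i 1) + g x
      = e n * (e n * H j i (x + s' *\<^sub>R axis j 1 + t' *\<^sub>R axis i 1))" using mixed[OF e0] by blast
    have swap: "x + e n *\<^sub>R axis j 1 + e n *\<^sub>R axis i 1 = x + e n *\<^sub>R axis i 1 + e n *\<^sub>R axis j 1" by (simp add: add_ac)
    have "e n * (e n * H i j (x + s *\<^sub>R axis i 1 + t *\<^sub>R axis j 1)) =
        e n * (e n * H j i (x + s' *\<^sub>R axis j 1 + t' *\<^sub>R axis i 1))"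
      using 1(5) 2(5) unfolding swap by linarith
    then have "H i j (x + s *\<^sub>R axis i 1 + t *\<^sub>R axis j 1) = H j i (x + s' *\<^sub>R axis j 1 + t' *\<^sub>R axis i 1)"
      using e0[of n] by simp
    with 1 2 show ?thesis by blast
  qed
  then obtain s t s' t' where r: "\<And>n. 0 < s n" "\<And>n. s n < e n" "\<And>n. 0 < t n" "\<And>n. t n < e n"
      "\<And>n. 0 < s' n" "\<And>n. s' n < e n" "\<And>n. 0 < t' n" "\<And>n. t' n < e n"
    and eq: "\<And>n. H i j (x + s n *\<^sub>R axis i 1 + t n *\<^sub>R axis j 1) = H j i (x + s' n *\<^sub>R axis j 1 + t' n *\<^sub>R axis i 1)"
    by metis
  have lim0: "u \<longlonglongrightarrow> 0" if "\<And>n. 0 < u n" "\<And>n. u n < e n" for u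
    by (rule tendsto_sandwich[OF _ _ tendsto_const elim]) (use that in \<open>auto intro: always_eventually less_imp_le\<close>)
  have lim: "(\<lambda>n. H i j (x + u n *\<^sub>R axis i 1 + v n *\<^sub>R axis j 1)) \<longlonglongrightarrow> H i j x"
    if "u \<longlonglongrightarrow> 0" "v \<longlonglongrightarrow> 0" for i j u v
  proof (rule isCont_tendsto_compose[of x "H i j"])
    show "isCont (H i j) x" using C2 by (simp add: C2_decay_def continuous_on_eq_continuous_at)
    show "(\<lambda>n. x + u n *\<^sub>R axis i 1 + v n *\<^sub>R axis j 1) \<longlonglongrightarrow> x"
      using that by (auto intro!: tendsto_eq_intros)
  qed
  have "(\<lambda>n. H i j (x + s n *\<^sub>R axis i 1 + t n *\<^sub>R axis j 1)) \<longlonglongrightarrow> H i j x"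
    by (intro lim lim0 r)
  moreover have "(\<lambda>n. H i j (x + s n *\<^sub>R axis i 1 + t n *\<^sub>R axis j 1)) \<longlonglongrightarrow> H j i x"
    unfolding eq by (intro lim lim0 r)
  ultimately show ?thesis by (rule LIMSEQ_unique)
qed

section \<open>From directional to mixed second derivatives\<close>

lemma hess_form_axis: "hess_form H (axis i 1) x = H i i x"
  by (simp add: hess_form_def axis_def if_distrib[of "\<lambda>c. c * _"] if_distrib[of "\<lambda>c. _ * c"] cong: if_cong)

lemma hess_form_two_axes:
  assumes "i \<noteq> j"
  shows "hess_form H (c *\<^sub>R axis i 1 + d *\<^sub>R axis j 1) x
    = c\<^sup>2 * H i i x + d\<^sup>2 * H j j x + c * d * (H i j x + H j i x)"
proof -
  let ?w = "c *\<^sub>R axis i 1 + d *\<^sub>R axis j 1 :: real ^ 'a"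
  have w: "(\<Sum>k\<in>UNIV. ?w $ k * f k) = c * f i + d * f j" for f :: "'a \<Rightarrow> real"
  proof -
    have "(\<Sum>k\<in>UNIV. ?w $ k * f k) = (\<Sum>k\<in>{i, j}. ?w $ k * f k)"
      by (rule sum.mono_neutral_right) (auto simp: axis_def)
    then show ?thesis using assms by (simp add: axis_def)
  qed
  have "hess_form H ?w x = (\<Sum>k\<in>UNIV. ?w $ k * (\<Sum>l\<in>UNIV. ?w $ l * H k l x))"
    by (simp only: hess_form_def sum_distrib_left mult.assoc)
  also have "\<dots> = c * (c * H i i x + d * H i j x) + d * (c * H j i x + d * H j j x)"
    by (simp only: w)
  finally show ?thesis by (simp add: power2_eq_square algebra_simps)
qed

text \<open>For each pair \<open>i\<close>, \<open>j\<close> an orthonormal system adapted to it is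
  used, so that the sum of its Hessian forms is always the trace. The constant doubles because two
  directions enter the bound of one entry.\<close>

lemma hess_Lp_bound:
  fixes p :: real
  assumes p: "1 < p"
  shows "\<exists>C>0. \<forall>g G H. C2_decay g G H \<longrightarrow> (\<forall>i j :: 'n::finite.
    (\<integral>\<^sup>+x. ennreal (\<bar>H i j x\<bar> powr p) \<partial>lborel)
      \<le> ennreal C * (\<integral>\<^sup>+x. ennreal (\<bar>\<Sum>k\<in>UNIV. H k k x\<bar> powr p) \<partial>lborel))"
proof -
  obtain C where C: "C > 0" and bound: "\<And>ws (w :: real ^ 'n) g G H. w \<in> set ws \<Longrightarrow> C2_decay g G H \<Longrightarrow>
    (\<integral>\<^sup>+x. ennreal (\<bar>hess_form H w x\<bar> powr p) \<partial>lborel)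
      \<le> ennreal C * (\<integral>\<^sup>+x. ennreal (\<bar>\<Sum>v\<leftarrow>ws. hess_form H v x\<bar> powr p) \<partial>lborel)"
    using hess_form_Lp_bound[OF p, where 'n = 'n] by blast
  have "(\<integral>\<^sup>+x. ennreal (\<bar>H i j x\<bar> powr p) \<partial>lborel)
      \<le> ennreal (2 * C) * (\<integral>\<^sup>+x. ennreal (\<bar>\<Sum>k\<in>UNIV. H k k x\<bar> powr p) \<partial>lborel)"
    if C2: "C2_decay g G H" for g G H and i j :: 'n
  proof -
    define I where "I = (\<integral>\<^sup>+x. ennreal (\<bar>\<Sum>k\<in>UNIV. H k k x\<bar> powr p) \<partial>lborel)"
    obtain ks where ks: "set ks = UNIV - {i, j}" "distinct ks"
      using finite_distinct_list[of "UNIV - {i, j}"] by auto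
    have rest: "(\<Sum>v\<leftarrow>map (\<lambda>k. axis k 1) ks. hess_form H v x) = (\<Sum>k\<in>UNIV - {i, j}. H k k x)" for x
      using ks by (simp add: o_def hess_form_axis sum_list_distinct_conv_sum_set)
    define a where "a = 1 / sqrt 2"
    have a: "a\<^sup>2 = 1/2" "(- a)\<^sup>2 = 1/2" "a * a = 1/2" by (simp_all add: a_def power_divide)
    \<comment> \<open>For \<open>i = j\<close> the second vector is 0: a step of length zero
      contributes nothing to the sum and keeps one list for both cases.\<close>
    define u where "u = (if i = j then axis i 1 else a *\<^sub>R axis i 1 + a *\<^sub>R axis j 1 :: real ^ 'n)"
    define v where "v = (if i = j then 0 else a *\<^sub>R axis i 1 + (- a) *\<^sub>R axis j 1 :: real ^ 'n)"
    define ws where "ws = u # v # map (\<lambda>k. axis k 1) ks"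
    have zero: "hess_form H 0 x = 0" for x by (simp add: hess_form_def)
    have "(\<Sum>w\<leftarrow>ws. hess_form H w x) = (\<Sum>k\<in>UNIV. H k k x)" for x
    proof -
      have "(\<Sum>k\<in>UNIV. H k k x) = (\<Sum>k\<in>{i, j}. H k k x) + (\<Sum>k\<in>UNIV - {i, j}. H k k x)"
        by (subst add.commute, rule sum.subset_diff) auto
      moreover have "hess_form H u x + hess_form H v x = (\<Sum>k\<in>{i, j}. H k k x)"
        by (cases "i = j") (simp_all add: u_def v_def hess_form_axis zero hess_form_two_axes a del: scaleR_minus_left)
      moreover have "(\<Sum>w\<leftarrow>ws. hess_form H w x) = (hess_form H u x + hess_form H v x)
          + (\<Sum>v\<leftarrow>map (\<lambda>k. axis k 1) ks. hess_form H v x)"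
        by (simp add: ws_def)
      ultimately show ?thesis unfolding rest by simp
    qed
    then have uv: "(\<integral>\<^sup>+x. ennreal (\<bar>hess_form H w x\<bar> powr p) \<partial>lborel) \<le> ennreal C * I" if "w = u \<or> w = v" for w
      using bound[OF _ C2, of w ws] that by (auto simp: I_def ws_def)
    have Hij: "\<bar>H i j x\<bar> \<le> max \<bar>hess_form H u x\<bar> \<bar>hess_form H v x\<bar>" for x
    proof (cases "i = j")
      case False
      \<comment> \<open>Polarization; the pure second derivatives cancel and symmetry of
        \<open>H\<close> merges the two mixed ones.\<close>
      have "hess_form H u x - hess_form H v x = 2 * H i j x"
        using False hess_symmetric[OF C2, of i j x] unfolding u_def v_def
        by (simp add: hess_form_two_axes a del: scaleR_minus_left)
      then show ?thesis by linarith
    qed (simp add: u_def hess_form_axis)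
    have m[measurable]: "hess_form H w \<in> borel_measurable borel" for w
      by (rule borel_measurable_continuous_onI[OF hess_form_continuous[OF C2]])
    have "(\<integral>\<^sup>+x. ennreal (\<bar>H i j x\<bar> powr p) \<partial>lborel)
      \<le> (\<integral>\<^sup>+x. ennreal (\<bar>hess_form H u x\<bar> powr p) + ennreal (\<bar>hess_form H v x\<bar> powr p) \<partial>lborel)"
    proof (rule nn_integral_mono)
      fix x
      have "\<bar>H i j x\<bar> powr p \<le> (max \<bar>hess_form H u x\<bar> \<bar>hess_form H v x\<bar>) powr p"
        using Hij p by (intro powr_mono2) auto
      also have "\<dots> \<le> \<bar>hess_form H u x\<bar> powr p + \<bar>hess_form H v x\<bar> powr p"
        by (simp add: max_def)
      finally show "ennreal (\<bar>H i j x\<bar> powr p) \<le> ennreal (\<bar>hess_form H u x\<bar> powr p) + ennreal (\<bar>hess_form H v x\<bar> powr p)"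
        by (simp add: ennreal_leI flip: ennreal_plus)
    qed
    also have "\<dots> = (\<integral>\<^sup>+x. ennreal (\<bar>hess_form H u x\<bar> powr p) \<partial>lborel) + (\<integral>\<^sup>+x. ennreal (\<bar>hess_form H v x\<bar> powr p) \<partial>lborel)"
      by (intro nn_integral_add) measurable
    also have "\<dots> \<le> ennreal C * I + ennreal C * I" by (intro add_mono uv) auto
    also have "\<dots> = ennreal (2 * C) * I" using C
      by (simp add: distrib_right[symmetric] ennreal_plus[symmetric] del: ennreal_plus)
    finally show ?thesis by (simp add: I_def)
  qed
  moreover have "2 * C > 0" using C by simp
  ultimately show ?thesis by blast
qed

section \<open>Partial derivatives of complex-valued functions\<close>

lemma partial_deriv_eq:
  fixes F :: "real ^ 'n \<Rightarrow> complex"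
  assumes "(F has_derivative F') (at y)"
  shows "partial_deriv k F y = F' (axis k 1)"
proof -
  have "((\<lambda>t. y + t *\<^sub>R axis k 1) has_derivative (\<lambda>h. h *\<^sub>R axis k 1)) (at 0)"
    by (auto intro!: derivative_eq_intros)
  from has_derivative_compose[OF this, of F F'] assms
  have "((\<lambda>t. F (y + t *\<^sub>R axis k 1)) has_derivative (\<lambda>h. F' (h *\<^sub>R axis k 1))) (at 0)" by simp
  moreover have "F' (h *\<^sub>R axis k 1) = h *\<^sub>R F' (axis k 1)" for h
    by (rule linear_scale[OF has_derivative_linear[OF assms]])
  ultimately have "((\<lambda>t. F (y + t *\<^sub>R axis k 1)) has_vector_derivative F' (axis k 1)) (at 0)"
    by (simp add: has_vector_derivative_def)
  then show ?thesis unfolding partial_deriv_def by (rule vector_derivative_at)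
qed

lemma differentiable_has_partial_derivs:
  fixes F :: "real ^ 'n \<Rightarrow> complex"
  assumes "F differentiable (at y)"
  shows "(F has_derivative (\<lambda>v. \<Sum>i\<in>UNIV. v $ i *\<^sub>R partial_deriv i F y)) (at y)"
proof -
  obtain F' where F': "(F has_derivative F') (at y)" using assms by (auto simp: differentiable_def)
  note lin = has_derivative_linear[OF F']
  have "F' v = (\<Sum>i\<in>UNIV. v $ i *\<^sub>R partial_deriv i F y)" for v
  proof -
    have "F' v = F' (\<Sum>i\<in>UNIV. v $ i *\<^sub>R axis i 1)"
      using basis_expansion[of v] by (simp add: scalar_mult_eq_scaleR)
    also have "\<dots> = (\<Sum>i\<in>UNIV. v $ i *\<^sub>R F' (axis i 1))"
      by (simp add: linear_sum[OF lin] linear_scale[OF lin])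
    finally show ?thesis by (simp add: partial_deriv_eq[OF F'])
  qed
  then have "F' = (\<lambda>v. \<Sum>i\<in>UNIV. v $ i *\<^sub>R partial_deriv i F y)" by (rule ext)
  with F' show ?thesis by simp
qed

text \<open>The interface between the chirp and the Hessian estimate. Differentiability is included
  so that each \<open>partial_deriv\<close> is a genuine derivative.\<close>

definition complex_C2_decay :: "(real ^ 'n \<Rightarrow> complex) \<Rightarrow> bool" where
  "complex_C2_decay F \<longleftrightarrow> (\<forall>y. F differentiable (at y)) \<and> (\<forall>j y. partial_deriv j F differentiable (at y)) \<and>
     (\<forall>j k. continuous_on UNIV (partial_deriv k (partial_deriv j F))) \<and>
     (\<exists>B. (\<forall>y. norm (F y) \<le> B * decay y) \<and>
        (\<forall>j k y. norm (partial_deriv k (partial_deriv j F) y) \<le> B * decay y))"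

lemma complex_C2_decay_Re_Im:
  fixes F :: "real ^ 'n \<Rightarrow> complex"
  assumes F: "complex_C2_decay F"
  shows "C2_decay (\<lambda>y. Re (F y)) (\<lambda>i y. Re (partial_deriv i F y)) (\<lambda>i j y. Re (partial_deriv j (partial_deriv i F) y))"
    and "C2_decay (\<lambda>y. Im (F y)) (\<lambda>i y. Im (partial_deriv i F y)) (\<lambda>i j y. Im (partial_deriv j (partial_deriv i F) y))"
proof -
  obtain B where B: "\<And>y. norm (F y) \<le> B * decay y"
    "\<And>j k y. norm (partial_deriv k (partial_deriv j F) y) \<le> B * decay y"
    using F by (auto simp: complex_C2_decay_def)
  have re: "((\<lambda>y. Re (G y)) has_derivative (\<lambda>v. \<Sum>i\<in>UNIV. v $ i * Re (partial_deriv i G y))) (at y)"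
    and im: "((\<lambda>y. Im (G y)) has_derivative (\<lambda>v. \<Sum>i\<in>UNIV. v $ i * Im (partial_deriv i G y))) (at y)"
    if "G differentiable (at y)" for G :: "real ^ 'n \<Rightarrow> complex" and y
    using has_derivative_Re[OF differentiable_has_partial_derivs[OF that]]
      has_derivative_Im[OF differentiable_has_partial_derivs[OF that]] by simp_all
  show "C2_decay (\<lambda>y. Re (F y)) (\<lambda>i y. Re (partial_deriv i F y)) (\<lambda>i j y. Re (partial_deriv j (partial_deriv i F) y))"
    unfolding C2_decay_def
  proof (intro conjI allI exI[of _ B])
    show "\<bar>Re (F y)\<bar> \<le> B * decay y" for y using B(1) by (rule order_trans[OF abs_Re_le_cmod])
    show "\<bar>Re (partial_deriv j (partial_deriv i F) y)\<bar> \<le> B * decay y" for i j y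
      using B(2) by (rule order_trans[OF abs_Re_le_cmod])
  qed (use F in \<open>auto simp: complex_C2_decay_def intro!: re continuous_on_Re\<close>)
  show "C2_decay (\<lambda>y. Im (F y)) (\<lambda>i y. Im (partial_deriv i F y)) (\<lambda>i j y. Im (partial_deriv j (partial_deriv i F) y))"
    unfolding C2_decay_def
  proof (intro conjI allI exI[of _ B])
    show "\<bar>Im (F y)\<bar> \<le> B * decay y" for y using B(1) by (rule order_trans[OF abs_Im_le_cmod])
    show "\<bar>Im (partial_deriv j (partial_deriv i F) y)\<bar> \<le> B * decay y" for i j y
      using B(2) by (rule order_trans[OF abs_Im_le_cmod])
  qed (use F in \<open>auto simp: complex_C2_decay_def intro!: im continuous_on_Im\<close>)
qed

text \<open>The Laplacian commutes with real and imaginary part, and each part is at most the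
  modulus. The factor \<open>2 powr p * 2\<close> in the constant comes from bounding the modulus by
  twice the larger part and adding the two estimates.\<close>

lemma second_partial_Lp_bound:
  fixes p :: real
  assumes p: "1 < p"
  shows "\<exists>C>0. \<forall>F :: real ^ 'n \<Rightarrow> complex. complex_C2_decay F \<longrightarrow> (\<forall>j k.
    (\<integral>\<^sup>+y. ennreal (norm (partial_deriv k (partial_deriv j F) y) powr p) \<partial>lborel)
      \<le> ennreal C * (\<integral>\<^sup>+y. ennreal (norm (laplacian F y) powr p) \<partial>lborel))"
proof -
  obtain C where C: "C > 0" and bound: "\<And>g G H i j. C2_decay g G H \<Longrightarrow>
    (\<integral>\<^sup>+x. ennreal (\<bar>H i j x\<bar> powr p) \<partial>lborel)
      \<le> ennreal C * (\<integral>\<^sup>+x. ennreal (\<bar>\<Sum>k\<in>(UNIV :: 'n set). H k k x\<bar> powr p) \<partial>lborel)"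
    using hess_Lp_bound[OF p, where 'n = 'n] by blast
  define C' where "C' = 2 powr p * (2 * C)"
  have "(\<integral>\<^sup>+y. ennreal (norm (partial_deriv k (partial_deriv j F) y) powr p) \<partial>lborel)
      \<le> ennreal C' * (\<integral>\<^sup>+y. ennreal (norm (laplacian F y) powr p) \<partial>lborel)"
    if F: "complex_C2_decay F" for F :: "real ^ 'n \<Rightarrow> complex" and j k
  proof -
    define D where "D = partial_deriv k (partial_deriv j F)"
    define L where "L = (\<integral>\<^sup>+y. ennreal (norm (laplacian F y) powr p) \<partial>lborel)"
    have "continuous_on UNIV D" using F by (simp add: D_def complex_C2_decay_def)
    then have [measurable]: "D \<in> borel_measurable borel" by (rule borel_measurable_continuous_onI)
    have re: "(\<integral>\<^sup>+y. ennreal (\<bar>Re (D y)\<bar> powr p) \<partial>lborel) \<le> ennreal C * L"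
    proof -
      have "(\<integral>\<^sup>+y. ennreal (\<bar>Re (D y)\<bar> powr p) \<partial>lborel)
        \<le> ennreal C * (\<integral>\<^sup>+y. ennreal (\<bar>\<Sum>i\<in>UNIV. Re (partial_deriv i (partial_deriv i F) y)\<bar> powr p) \<partial>lborel)"
        unfolding D_def by (rule bound[OF complex_C2_decay_Re_Im(1)[OF F]])
      also have "\<dots> \<le> ennreal C * L" unfolding L_def
      proof (intro mult_left_mono nn_integral_mono ennreal_leI powr_mono2)
        show "\<bar>\<Sum>i\<in>UNIV. Re (partial_deriv i (partial_deriv i F) y)\<bar> \<le> norm (laplacian F y)" for y
          using abs_Re_le_cmod[of "laplacian F y"] by (simp add: laplacian_def)
      qed (use p in auto)
      finally show ?thesis .
    qed
    have im: "(\<integral>\<^sup>+y. ennreal (\<bar>Im (D y)\<bar> powr p) \<partial>lborel) \<le> ennreal C * L"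
    proof -
      have "(\<integral>\<^sup>+y. ennreal (\<bar>Im (D y)\<bar> powr p) \<partial>lborel)
        \<le> ennreal C * (\<integral>\<^sup>+y. ennreal (\<bar>\<Sum>i\<in>UNIV. Im (partial_deriv i (partial_deriv i F) y)\<bar> powr p) \<partial>lborel)"
        unfolding D_def by (rule bound[OF complex_C2_decay_Re_Im(2)[OF F]])
      also have "\<dots> \<le> ennreal C * L" unfolding L_def
      proof (intro mult_left_mono nn_integral_mono ennreal_leI powr_mono2)
        show "\<bar>\<Sum>i\<in>UNIV. Im (partial_deriv i (partial_deriv i F) y)\<bar> \<le> norm (laplacian F y)" for y
          using abs_Im_le_cmod[of "laplacian F y"] by (simp add: laplacian_def)
      qed (use p in auto)
      finally show ?thesis .
    qed
    have "(\<integral>\<^sup>+y. ennreal (norm (D y) powr p) \<partial>lborel)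
      \<le> (\<integral>\<^sup>+y. ennreal (2 powr p) * (ennreal (\<bar>Re (D y)\<bar> powr p) + ennreal (\<bar>Im (D y)\<bar> powr p)) \<partial>lborel)"
    proof (rule nn_integral_mono)
      fix y
      have "norm (D y) powr p \<le> (2 * max \<bar>Re (D y)\<bar> \<bar>Im (D y)\<bar>) powr p"
        using p cmod_le[of "D y"] by (intro powr_mono2) auto
      also have "\<dots> = 2 powr p * max \<bar>Re (D y)\<bar> \<bar>Im (D y)\<bar> powr p" by (simp add: powr_mult)
      also have "\<dots> \<le> 2 powr p * (\<bar>Re (D y)\<bar> powr p + \<bar>Im (D y)\<bar> powr p)"
        by (intro mult_left_mono) (auto simp: max_def)
      finally show "ennreal (norm (D y) powr p)
          \<le> ennreal (2 powr p) * (ennreal (\<bar>Re (D y)\<bar> powr p) + ennreal (\<bar>Im (D y)\<bar> powr p))"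
        by (simp add: ennreal_leI flip: ennreal_plus ennreal_mult)
    qed
    also have "\<dots> = ennreal (2 powr p) * ((\<integral>\<^sup>+y. ennreal (\<bar>Re (D y)\<bar> powr p) \<partial>lborel)
        + (\<integral>\<^sup>+y. ennreal (\<bar>Im (D y)\<bar> powr p) \<partial>lborel))"
      by (subst nn_integral_cmult, measurable, subst nn_integral_add) measurable
    also have "\<dots> \<le> ennreal (2 powr p) * (ennreal C * L + ennreal C * L)"
      by (intro mult_left_mono add_mono re im) auto
    also have "ennreal C * L + ennreal C * L = ennreal (2 * C) * L" using C
      by (simp add: distrib_right[symmetric] ennreal_plus[symmetric] del: ennreal_plus)
    also have "ennreal (2 powr p) * (ennreal (2 * C) * L) = ennreal C' * L"
    proof -
      have "ennreal C' = ennreal (2 powr p) * ennreal (2 * C)"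
        unfolding C'_def using C by (intro ennreal_mult) auto
      then show ?thesis by (simp only: mult.assoc)
    qed
    finally show ?thesis by (simp add: D_def L_def)
  qed
  moreover have "C' > 0" using C by (simp add: C'_def)
  ultimately show ?thesis by blast
qed

section \<open>Chirped Schwartz functions\<close>

text \<open>Decay of the function alone. Derivatives enter by applying this to each of them
  separately, which keeps the notion stable under multiplication by coordinates and by bounded
  functions.\<close>

definition rapid :: "(real ^ 'n \<Rightarrow> complex) \<Rightarrow> bool" where
  "rapid u \<longleftrightarrow> (\<forall>m. \<exists>B. \<forall>y. \<bar>\<Prod>i\<in>UNIV. (y $ i) ^ m i\<bar> * norm (u y) \<le> B)"

lemma rapid_add: "rapid u \<Longrightarrow> rapid v \<Longrightarrow> rapid (\<lambda>y. u y + v y)"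
  unfolding rapid_def
proof (intro allI)
  fix m
  assume "\<forall>m. \<exists>B. \<forall>y. \<bar>\<Prod>i\<in>UNIV. (y $ i) ^ m i\<bar> * norm (u y) \<le> B"
    and "\<forall>m. \<exists>B. \<forall>y. \<bar>\<Prod>i\<in>UNIV. (y $ i) ^ m i\<bar> * norm (v y) \<le> B"
  then obtain A B where AB: "\<And>y. \<bar>\<Prod>i\<in>UNIV. (y $ i) ^ m i\<bar> * norm (u y) \<le> A"
    "\<And>y. \<bar>\<Prod>i\<in>UNIV. (y $ i) ^ m i\<bar> * norm (v y) \<le> B" by metis
  have "\<bar>\<Prod>i\<in>UNIV. (y $ i) ^ m i\<bar> * norm (u y + v y) \<le> A + B" for y
  proof -
    have "\<bar>\<Prod>i\<in>UNIV. (y $ i) ^ m i\<bar> * norm (u y + v y) \<le> \<bar>\<Prod>i\<in>UNIV. (y $ i) ^ m i\<bar> * (norm (u y) + norm (v y))"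
      by (intro mult_left_mono norm_triangle_ineq) auto
    then show ?thesis using AB[of y] by (simp add: distrib_left)
  qed
  then show "\<exists>B. \<forall>y. \<bar>\<Prod>i\<in>UNIV. (y $ i) ^ m i\<bar> * norm (u y + v y) \<le> B" by blast
qed

lemma rapid_mult_bounded:
  assumes u: "rapid u" and e: "\<And>y. norm (e y) \<le> K"
  shows "rapid (\<lambda>y. e y * u y)"
  unfolding rapid_def
proof (intro allI)
  fix m
  obtain B where B: "\<And>y. \<bar>\<Prod>i\<in>UNIV. (y $ i) ^ m i\<bar> * norm (u y) \<le> B"
    using u unfolding rapid_def by metis
  have K: "K \<ge> 0" using order_trans[OF norm_ge_zero e] .
  have "\<bar>\<Prod>i\<in>UNIV. (y $ i) ^ m i\<bar> * norm (e y * u y) \<le> K * B" for y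
  proof -
    have "\<bar>\<Prod>i\<in>UNIV. (y $ i) ^ m i\<bar> * norm (e y * u y) = norm (e y) * (\<bar>\<Prod>i\<in>UNIV. (y $ i) ^ m i\<bar> * norm (u y))"
      by (simp only: norm_mult mult_ac)
    also have "\<dots> \<le> K * B" by (intro mult_mono e B K) auto
    finally show ?thesis .
  qed
  then show "\<exists>B. \<forall>y. \<bar>\<Prod>i\<in>UNIV. (y $ i) ^ m i\<bar> * norm (e y * u y) \<le> B" by blast
qed

lemma rapid_coordinate:
  assumes u: "rapid u"
  shows "rapid (\<lambda>y. of_real (y $ k) * u y)"
  unfolding rapid_def
proof (intro allI)
  fix m :: "'a \<Rightarrow> nat"
  \<comment> \<open>The extra factor \<open>y $ k\<close> is absorbed by raising the exponent of
    that coordinate by one.\<close>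
  obtain B where B: "\<And>y. \<bar>\<Prod>i\<in>UNIV. (y $ i) ^ (m(k := Suc (m k))) i\<bar> * norm (u y) \<le> B"
    using u unfolding rapid_def by metis
  have "(\<Prod>i\<in>UNIV. (y $ i) ^ (m(k := Suc (m k))) i) = y $ k * (\<Prod>i\<in>UNIV. (y $ i) ^ m i)" for y :: "real ^ 'a"
    by (simp add: prod.remove[of UNIV k] mult.assoc)
  then have "\<bar>\<Prod>i\<in>UNIV. (y $ i) ^ m i\<bar> * norm (of_real (y $ k) * u y) \<le> B" for y
    using B[of y] by (simp add: norm_mult abs_mult mult_ac)
  then show "\<exists>B. \<forall>y. \<bar>\<Prod>i\<in>UNIV. (y $ i) ^ m i\<bar> * norm (of_real (y $ k) * u y) \<le> B" by blast
qed

text \<open>The reciprocal of \<open>decay\<close> is the product of all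
  \<open>1 + (y $ i)^2\<close> and expands into a sum over subsets \<open>X\<close> of the
  coordinates; each summand is a monomial with exponents 0 and 2, bounded against \<open>u\<close>
  by rapid decay.\<close>

lemma rapid_le_decay:
  fixes u :: "real ^ 'n \<Rightarrow> complex"
  assumes u: "rapid u"
  shows "\<exists>B. \<forall>y. norm (u y) \<le> B * decay y"
proof -
  have "\<forall>X. \<exists>B. \<forall>y. \<bar>\<Prod>i\<in>UNIV. (y $ i) ^ (if i \<in> X then 2 else 0)\<bar> * norm (u y) \<le> B"
  proof
    show "\<exists>B. \<forall>y. \<bar>\<Prod>i\<in>UNIV. (y $ i) ^ (if i \<in> X then 2 else 0)\<bar> * norm (u y) \<le> B" for X
      using u[unfolded rapid_def, rule_format, of "\<lambda>i. if i \<in> X then 2 else 0"] .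
  qed
  then obtain B where B: "\<And>X y. \<bar>\<Prod>i\<in>UNIV. (y $ i) ^ (if i \<in> X then 2 else 0)\<bar> * norm (u y) \<le> B X"
    by metis
  have "norm (u y) \<le> (\<Sum>X\<in>UNIV. B X) * decay y" for y
  proof -
    have X: "(\<Prod>i\<in>X. (y $ i)\<^sup>2) = (\<Prod>i\<in>UNIV. (y $ i) ^ (if i \<in> X then 2 else 0))" for X
      by (rule prod.mono_neutral_cong_left) auto
    have "(\<Prod>i\<in>UNIV. 1 + (y $ i)\<^sup>2) = (\<Sum>X\<in>UNIV. (\<Prod>i\<in>X. (y $ i)\<^sup>2))"
      using prod_add[of "UNIV :: 'n set" "\<lambda>i. (y $ i)\<^sup>2" "\<lambda>_. 1"] by (simp add: add.commute)
    then have "(\<Prod>i\<in>UNIV. 1 + (y $ i)\<^sup>2) * norm (u y) = (\<Sum>X\<in>UNIV. (\<Prod>i\<in>X. (y $ i)\<^sup>2) * norm (u y))"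
      by (simp add: sum_distrib_right)
    also have "\<dots> \<le> (\<Sum>X\<in>UNIV. B X)"
    proof (rule sum_mono)
      fix X
      have "(\<Prod>i\<in>X. (y $ i)\<^sup>2) \<le> \<bar>\<Prod>i\<in>UNIV. (y $ i) ^ (if i \<in> X then 2 else 0)\<bar>" unfolding X by simp
      then show "(\<Prod>i\<in>X. (y $ i)\<^sup>2) * norm (u y) \<le> B X"
        by (rule order_trans[OF mult_right_mono B]) simp
    qed
    finally have "(\<Prod>i\<in>UNIV. 1 + (y $ i)\<^sup>2) * norm (u y) * decay y \<le> (\<Sum>X\<in>UNIV. B X) * decay y"
      using decay_pos[of y] by (intro mult_right_mono) auto
    moreover have "(\<Prod>i\<in>UNIV. 1 + (y $ i)\<^sup>2) * decay y = 1"
    proof -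
      have "1 + (y $ i)\<^sup>2 \<noteq> 0" for i using zero_le_power2[of "y $ i"] by linarith
      then show ?thesis by (simp add: decay_def flip: prod.distrib)
    qed
    ultimately show ?thesis by (metis mult.assoc mult.commute mult_1)
  qed
  then show ?thesis by blast
qed

definition tame :: "(real ^ 'n \<Rightarrow> complex) \<Rightarrow> bool" where
  "tame u \<longleftrightarrow> (\<forall>y. u differentiable (at y)) \<and> rapid u"

lemma tame_schwartz: "f \<in> schwartz \<Longrightarrow> tame (iterated_partial ks f)"
  unfolding tame_def rapid_def
proof (intro conjI allI)
  assume f: "f \<in> schwartz"
  show "iterated_partial ks f differentiable (at y)" for y
    using f by (simp add: schwartz_def smooth_def)
  fix m
  have "bounded (range (\<lambda>y. of_real (\<Prod>i\<in>UNIV. (y $ i) ^ m i) * iterated_partial ks f y))"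
    using f unfolding schwartz_def by blast
  then obtain B where "\<And>y. norm (of_real (\<Prod>i\<in>UNIV. (y $ i) ^ m i) * iterated_partial ks f y) \<le> B"
    unfolding bounded_iff by blast
  then show "\<exists>B. \<forall>y. \<bar>\<Prod>i\<in>UNIV. (y $ i) ^ m i\<bar> * norm (iterated_partial ks f y) \<le> B"
    unfolding norm_mult norm_of_real by blast
qed

lemma tame_add: "tame u \<Longrightarrow> tame v \<Longrightarrow> tame (\<lambda>y. u y + v y)"
  by (auto simp: tame_def intro: rapid_add differentiable_add)

lemma tame_cmult: "tame u \<Longrightarrow> tame (\<lambda>y. c * u y)"
  by (auto simp: tame_def intro!: rapid_mult_bounded[of _ _ "norm c"] differentiable_mult)

lemma differentiable_coordinate: "(\<lambda>y :: real ^ 'n. complex_of_real (y $ k)) differentiable (at y)"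
  by (rule bounded_linear_imp_differentiable)
     (intro bounded_linear_compose[OF bounded_linear_of_real] bounded_linear_vec_nth)

lemma tame_coordinate: "tame u \<Longrightarrow> tame (\<lambda>y. of_real (y $ k) * u y)"
  by (auto simp: tame_def intro!: rapid_coordinate differentiable_mult differentiable_coordinate)

lemma chirp_has_derivative:
  "(chirp \<alpha> has_derivative (\<lambda>v. chirp \<alpha> y * (\<Sum>k\<in>UNIV. \<i> * of_real (cot (\<alpha> $ k) * y $ k * v $ k)))) (at y)"
proof -
  have "((\<lambda>y. \<Sum>k\<in>UNIV. (y $ k)\<^sup>2 * cot (\<alpha> $ k)) has_derivative
      (\<lambda>v. \<Sum>k\<in>UNIV. 2 * (cot (\<alpha> $ k) * y $ k * v $ k))) (at y)"
  proof (rule has_derivative_sum)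
    fix k
    have "((\<lambda>y :: real ^ 'a. y $ k) has_derivative (\<lambda>v. v $ k)) (at y)"
      by (rule bounded_linear_imp_has_derivative[OF bounded_linear_vec_nth])
    then show "((\<lambda>y. (y $ k)\<^sup>2 * cot (\<alpha> $ k)) has_derivative (\<lambda>v. 2 * (cot (\<alpha> $ k) * y $ k * v $ k))) (at y)"
      by (rule has_derivative_eq_rhs[OF has_derivative_mult_left[OF has_derivative_power]]) (simp add: mult_ac)
  qed
  from has_derivative_compose[OF has_derivative_mult_right[OF has_derivative_of_real[OF this], of "\<i> / 2"]
      DERIV_exp[unfolded has_field_derivative_def]]
  show ?thesis unfolding chirp_def[abs_def]
    by (rule has_derivative_eq_rhs) (simp add: sum_distrib_left mult_ac)
qed

lemma norm_chirp: "norm (chirp \<alpha> y) = 1"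
  by (simp add: chirp_def norm_exp_eq_Re)

text \<open>The derivative conjugated by the chirp: \<open>partial_deriv k\<close> after
  multiplication by \<open>chirp \<alpha>\<close> equals multiplication by
  \<open>chirp \<alpha>\<close> after this operator. Iterated derivatives thus keep the chirp as a
  single unimodular factor.\<close>

definition chirped_partial :: "real ^ 'n \<Rightarrow> 'n \<Rightarrow> (real ^ 'n \<Rightarrow> complex) \<Rightarrow> real ^ 'n \<Rightarrow> complex" where
  "chirped_partial \<alpha> k u = (\<lambda>y. partial_deriv k u y + (\<i> * of_real (cot (\<alpha> $ k))) * (of_real (y $ k) * u y))"

lemma partial_deriv_chirp_mult:
  assumes "\<And>y. u differentiable (at y)"
  shows "partial_deriv k (\<lambda>y. chirp \<alpha> y * u y) = (\<lambda>y. chirp \<alpha> y * chirped_partial \<alpha> k u y)"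
proof
  fix y
  have "(\<Sum>i\<in>UNIV. \<i> * complex_of_real (cot (\<alpha> $ i) * y $ i * axis k 1 $ i)) = \<i> * of_real (cot (\<alpha> $ k) * y $ k)"
    by (simp add: axis_def if_distrib[of "\<lambda>c. _ * c"] if_distrib[of complex_of_real] cong: if_cong)
  moreover have "(\<Sum>i\<in>UNIV. axis k 1 $ i *\<^sub>R partial_deriv i u y) = partial_deriv k u y"
    by (simp add: axis_def if_distrib[of "\<lambda>c. c *\<^sub>R _"] cong: if_cong)
  ultimately show "partial_deriv k (\<lambda>y. chirp \<alpha> y * u y) y = chirp \<alpha> y * chirped_partial \<alpha> k u y"
    using partial_deriv_eq[OF has_derivative_mult[OF chirp_has_derivative differentiable_has_partial_derivs[OF assms]], of k \<alpha> y]
    by (simp add: chirped_partial_def algebra_simps)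
qed

lemma partial_deriv_chirped_partial:
  assumes "\<And>y. u differentiable (at y)" "\<And>y. partial_deriv k u differentiable (at y)"
  shows "partial_deriv j (chirped_partial \<alpha> k u) = (\<lambda>y. partial_deriv j (partial_deriv k u) y
    + (\<i> * of_real (cot (\<alpha> $ k))) * ((if j = k then 1 else 0) * u y + of_real (y $ k) * partial_deriv j u y))"
proof
  fix y
  have d: "((\<lambda>y. complex_of_real (y $ k)) has_derivative (\<lambda>v. of_real (v $ k))) (at y)"
    by (rule bounded_linear_imp_has_derivative)
       (intro bounded_linear_compose[OF bounded_linear_of_real] bounded_linear_vec_nth)
  have 1: "(\<Sum>i\<in>UNIV. axis j 1 $ i *\<^sub>R partial_deriv i v y) = partial_deriv j v y" for v
    by (simp add: axis_def if_distrib[of "\<lambda>c. c *\<^sub>R _"] cong: if_cong)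
  have "axis j 1 $ k = (if j = k then 1 else 0 :: real)" by (simp add: axis_def)
  then show "partial_deriv j (chirped_partial \<alpha> k u) y = partial_deriv j (partial_deriv k u) y
    + (\<i> * of_real (cot (\<alpha> $ k))) * ((if j = k then 1 else 0) * u y + of_real (y $ k) * partial_deriv j u y)"
    unfolding chirped_partial_def
    using partial_deriv_eq[OF has_derivative_add[OF differentiable_has_partial_derivs[OF assms(2)]
      has_derivative_mult_right[OF has_derivative_mult[OF d differentiable_has_partial_derivs[OF assms(1)]]]],
      of j "\<i> * of_real (cot (\<alpha> $ k))"]
    unfolding 1 by (simp add: algebra_simps)
qed

text \<open>Derivatives of the chirp grow polynomially, but only through the coordinate factors in
  \<open>chirped_partial\<close>, which rapid decay of \<open>f\<close> and its derivatives absorbs;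
  the remaining chirp has modulus 1.\<close>

lemma complex_C2_decay_chirp_schwartz:
  assumes f: "f \<in> schwartz"
  shows "complex_C2_decay (\<lambda>y. chirp \<alpha> y * f y)"
proof -
  have t0: "tame f" using tame_schwartz[OF f, of "[]"] by simp
  have t1: "tame (partial_deriv k f)" for k using tame_schwartz[OF f, of "[k]"] by simp
  have t2: "tame (partial_deriv j (partial_deriv k f))" for j k using tame_schwartz[OF f, of "[j, k]"] by simp
  have M: "tame (chirped_partial \<alpha> k f)" for k
    unfolding chirped_partial_def by (intro tame_add tame_cmult tame_coordinate t0 t1)
  have MM: "tame (chirped_partial \<alpha> j (chirped_partial \<alpha> k f))" for j k
  proof -
    have "partial_deriv j (chirped_partial \<alpha> k f) = (\<lambda>y. partial_deriv j (partial_deriv k f) y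
      + (\<i> * of_real (cot (\<alpha> $ k))) * ((if j = k then 1 else 0) * f y + of_real (y $ k) * partial_deriv j f y))"
      using t0 t1 by (intro partial_deriv_chirped_partial) (auto simp: tame_def)
    then have "tame (partial_deriv j (chirped_partial \<alpha> k f))"
      using t0 t1 t2 by (auto intro!: tame_add tame_cmult tame_coordinate)
    then show ?thesis
      unfolding chirped_partial_def[of \<alpha> j] by (intro tame_add tame_cmult tame_coordinate M)
  qed
  have d1: "partial_deriv k (\<lambda>y. chirp \<alpha> y * f y) = (\<lambda>y. chirp \<alpha> y * chirped_partial \<alpha> k f y)" for k
    using t0 by (intro partial_deriv_chirp_mult) (simp add: tame_def)
  have d2: "partial_deriv j (partial_deriv k (\<lambda>y. chirp \<alpha> y * f y))
      = (\<lambda>y. chirp \<alpha> y * chirped_partial \<alpha> j (chirped_partial \<alpha> k f) y)" for j k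
    unfolding d1 using M by (intro partial_deriv_chirp_mult) (simp add: tame_def)
  have chirp_tame: "tame (\<lambda>y. chirp \<alpha> y * u y)" if "tame u" for u
    using that unfolding tame_def
    by (auto intro!: rapid_mult_bounded[of _ _ 1] differentiable_mult simp: norm_chirp)
       (auto simp: differentiable_def intro: chirp_has_derivative)
  have t: "tame (\<lambda>y. chirp \<alpha> y * f y)" by (rule chirp_tame[OF t0])
  have t': "tame (partial_deriv k (\<lambda>y. chirp \<alpha> y * f y))" for k
    unfolding d1 by (rule chirp_tame[OF M])
  \<comment> \<open>Being tame serves twice here: rapid decay yields the bound by
    \<open>decay\<close>, and differentiability yields continuity of the second derivatives.\<close>
  have t'': "tame (partial_deriv j (partial_deriv k (\<lambda>y. chirp \<alpha> y * f y)))" for j k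
    unfolding d2 by (rule chirp_tame[OF MM])
  have cont: "continuous_on UNIV u" if "tame u" for u :: "real ^ 'a \<Rightarrow> complex"
    using that by (intro continuous_at_imp_continuous_on)
      (auto simp: tame_def intro: differentiable_imp_continuous_within)
  have "\<exists>B. \<forall>y. norm (chirp \<alpha> y * f y) \<le> B * decay y"
    using t by (intro rapid_le_decay) (simp add: tame_def)
  then obtain B0 where B0: "\<And>y. norm (chirp \<alpha> y * f y) \<le> B0 * decay y" by blast
  have "\<forall>j k. \<exists>B. \<forall>y. norm (partial_deriv j (partial_deriv k (\<lambda>y. chirp \<alpha> y * f y)) y) \<le> B * decay y"
    using t'' by (intro allI rapid_le_decay) (simp add: tame_def)
  then obtain B where B: "\<And>j k y. norm (partial_deriv j (partial_deriv k (\<lambda>y. chirp \<alpha> y * f y)) y) \<le> B j k * decay y"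
    by metis
  \<comment> \<open>A single constant for the function and all its second derivatives; the absolute
    values let every summand be dropped.\<close>
  define S where "S = \<bar>B0\<bar> + (\<Sum>j\<in>UNIV. \<Sum>k\<in>UNIV. \<bar>B j k\<bar>)"
  have S: "B0 \<le> S" "B j k \<le> S" for j k
  proof -
    have "\<bar>B j k\<bar> \<le> (\<Sum>k\<in>UNIV. \<bar>B j k\<bar>)" by (rule member_le_sum) auto
    also have "\<dots> \<le> (\<Sum>j\<in>UNIV. \<Sum>k\<in>UNIV. \<bar>B j k\<bar>)"
      by (rule member_le_sum) (auto intro: sum_nonneg)
    finally show "B j k \<le> S" by (simp add: S_def)
    have "0 \<le> (\<Sum>j\<in>UNIV. \<Sum>k\<in>UNIV. \<bar>B j k\<bar>)" by (intro sum_nonneg) auto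
    then show "B0 \<le> S" by (simp add: S_def)
  qed
  show ?thesis
    unfolding complex_C2_decay_def
  proof (intro conjI allI exI[of _ S])
    show "norm (chirp \<alpha> y * f y) \<le> S * decay y" for y
      by (rule order_trans[OF B0 mult_right_mono[OF S(1)]]) (simp add: decay_pos less_imp_le)
    show "norm (partial_deriv k (partial_deriv j (\<lambda>y. chirp \<alpha> y * f y)) y) \<le> S * decay y" for j k y
      by (rule order_trans[OF B mult_right_mono[OF S(2)]]) (simp add: decay_pos less_imp_le)
  qed (use t t' t'' cont in \<open>auto simp: tame_def\<close>)
qed

text \<open>Taking the \<open>p\<close>-th root turns \<open>C\<close> into its root.
  \<open>Lp_norm\<close> integrates over the completion of \<open>lborel\<close>, where the
  nonnegative integral is the same. If the integral for \<open>g\<close> is infinite, the right-hand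
  side is infinite because \<open>C > 0\<close>.\<close>

lemma Lp_norm_le:
  assumes p: "1 < p" and C: "C > 0"
    and le: "(\<integral>\<^sup>+y. ennreal (norm (f y) powr p) \<partial>lborel) \<le> ennreal C * (\<integral>\<^sup>+y. ennreal (norm (g y) powr p) \<partial>lborel)"
  shows "Lp_norm p f \<le> ennreal (C powr (1 / p)) * Lp_norm p g"
proof (cases "(\<integral>\<^sup>+y. ennreal (norm (g y) powr p) \<partial>lborel)" rule: ennreal_cases)
  case (real r)
  then have "(\<integral>\<^sup>+y. ennreal (norm (f y) powr p) \<partial>lborel) \<le> ennreal (C * r)"
    using le C by (simp add: ennreal_mult)
  then obtain s where s: "(\<integral>\<^sup>+y. ennreal (norm (f y) powr p) \<partial>lborel) = ennreal s" "0 \<le> s" "s \<le> C * r"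
    using C real by (cases "(\<integral>\<^sup>+y. ennreal (norm (f y) powr p) \<partial>lborel)" rule: ennreal_cases)
      (auto simp: ennreal_le_iff top_unique)
  have "s powr (1 / p) \<le> (C * r) powr (1 / p)" using s p by (intro powr_mono2) auto
  also have "\<dots> = C powr (1 / p) * r powr (1 / p)" using C real by (simp add: powr_mult)
  finally show ?thesis
    using s real by (simp add: Lp_norm_def nn_integral_completion ennreal_leI flip: ennreal_mult)
next
  case top
  then show ?thesis using C by (simp add: Lp_norm_def nn_integral_completion ennreal_mult_top)
qed

theorem theorem4p6:
  fixes \<alpha> :: "real ^ 'n" and p :: real
  assumes "\<And>k. \<alpha> $ k \<notin> {pi * of_int m | m :: int. True}"
    and "1 < p"
  shows "\<exists>C::real. C > 0 \<and>
    (\<forall>f \<in> schwartz. \<forall>j k.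
       Lp_norm p (partial_deriv k (partial_deriv j (\<lambda>y. chirp \<alpha> y * f y)))
         \<le> ennreal C * Lp_norm p (laplacian (\<lambda>y. chirp \<alpha> y * f y)))"
proof -
  obtain C where C: "C > 0" and bound: "\<And>F j k. complex_C2_decay F \<Longrightarrow>
    (\<integral>\<^sup>+y. ennreal (norm (partial_deriv k (partial_deriv j F) y) powr p) \<partial>lborel)
      \<le> ennreal C * (\<integral>\<^sup>+(y :: real ^ 'n). ennreal (norm (laplacian F y) powr p) \<partial>lborel)"
    using second_partial_Lp_bound[OF \<open>1 < p\<close>, where 'n = 'n] by blast
  show ?thesis
  proof (intro exI[of _ "C powr (1 / p)"] conjI ballI allI)
    show "C powr (1 / p) > 0" using C by simp
    show "Lp_norm p (partial_deriv k (partial_deriv j (\<lambda>y. chirp \<alpha> y * f y)))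
         \<le> ennreal (C powr (1 / p)) * Lp_norm p (laplacian (\<lambda>y. chirp \<alpha> y * f y))" if "f \<in> schwartz" for f j k
      by (intro Lp_norm_le \<open>1 < p\<close> C bound complex_C2_decay_chirp_schwartz that)
  qed
qed

end
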